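(* Let $\lambda=(\lambda_1,\dots,\lambda_m)$ be a partition with $m=l(\lambda)$, let $\mu$ be its conjugate partition and $n=l(\mu)=\lambda_1$. For every integer $k\ge\max(l(\lambda),\lambda_1)$, $$D_\lambda(k)=2^{\binom k2-|\lambda|}\,[y_1^{\lambda_1+m-1}y_2^{\lambda_2+m-2}\cdots y_m^{\lambda_m}]\Bigl(\prod_{1\le i<j\le m}(y_i-y_j)(1-y_i-y_j)\prod_{l=1}^m(1-y_l)^{-k-m}\Bigr),$$ and also $$D_\lambda(k)=2^{\binom k2-|\lambda|}\,[z_1^{\mu_1+n-1}z_2^{\mu_2+n-2}\cdots z_n^{\mu_n}]\Bigl(\prod_{1\le i<j\le n}(z_i-z_j)(1+z_i+z_j)\prod_{l=1}^n(1+2z_l)(1+z_l)^{k-n}\Bigr).$$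
   Context: A partition $\lambda$ is a weakly decreasing sequence of nonnegative integers with finitely many nonzero terms; $l(\lambda)$ is the number of nonzero parts, $|\lambda|=\sum\lambda_i$, and $\lambda_i=0$ for $i>l(\lambda)$. The conjugate partition $\mu=\lambda'$ has $\mu_i=\#\{j:\lambda_j\ge i\}$. For such $\lambda$ and $k\ge\max(l(\lambda),\lambda_1)$ define the $k\times k$ determinant $D_\lambda(k)=\det\bigl(\binom{2k-i-\lambda_{k-i+1}}{2k-2j}\bigr)_{1\le i,j\le k}$ (binomial coefficients $\binom{N}{r}=0$ for $r>N$). For a formal power series $f$ in variables $y$, $[y_1^{u_1}\cdots y_m^{u_m}]f$ denotes the coefficient of $y_1^{u_1}\cdots y_m^{u_m}$ in $f$. *)

theory Defs
  imports "HOL-Library.Poly_Mapping" "Jordan_Normal_Form.Determinant"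
begin

section \<open>Partitions\<close>

text \<open>
  A partition is a sequence \<open>lam 1 \<ge> lam 2 \<ge> \<dots>\<close> with finitely many nonzero terms. Sequences are
  indexed from 1 and none of the definitions below looks at the value at 0.
\<close>

definition is_partition :: "(nat \<Rightarrow> nat) \<Rightarrow> bool" where
  "is_partition lam \<longleftrightarrow>
     (\<forall>i j. 1 \<le> i \<and> i \<le> j \<longrightarrow> lam j \<le> lam i) \<and> finite {i. 1 \<le> i \<and> lam i \<noteq> 0}"

definition part_length :: "(nat \<Rightarrow> nat) \<Rightarrow> nat" where
  "part_length lam = card {i. 1 \<le> i \<and> lam i \<noteq> 0}"

definition part_size :: "(nat \<Rightarrow> nat) \<Rightarrow> nat" where
  "part_size lam = (\<Sum>i\<in>{i. 1 \<le> i \<and> lam i \<noteq> 0}. lam i)"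

definition conj_part :: "(nat \<Rightarrow> nat) \<Rightarrow> nat \<Rightarrow> nat" where
  "conj_part lam i = card {j. 1 \<le> j \<and> i \<le> lam j}"

lemma part_length_conj_part:
  assumes "is_partition lam"
  shows "part_length (conj_part lam) = lam 1"
proof -
  have "conj_part lam i \<noteq> 0 \<longleftrightarrow> i \<le> lam 1" if "1 \<le> i" for i
  proof -
    have "finite {j. 1 \<le> j \<and> i \<le> lam j}"
      by (rule finite_subset[of _ "{j. 1 \<le> j \<and> lam j \<noteq> 0}"])
         (use assms that in \<open>auto simp: is_partition_def\<close>)
    hence "conj_part lam i \<noteq> 0 \<longleftrightarrow> (\<exists>j. 1 \<le> j \<and> i \<le> lam j)"
      by (auto simp: conj_part_def)
    also have "\<dots> \<longleftrightarrow> i \<le> lam 1"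
      using assms by (metis is_partition_def le_refl le_trans)
    finally show ?thesis .
  qed
  hence "{i. 1 \<le> i \<and> conj_part lam i \<noteq> 0} = {1..lam 1}"
    by auto
  thus ?thesis
    by (simp add: part_length_def)
qed

section \<open>The determinant\<close>

text \<open>
  Matrix indices start at 0, so the entry at \<open>(i, j)\<close> is the one at \<open>(i + 1, j + 1)\<close> in the usual
  indexing; in particular \<open>lam (k - i)\<close> stands for \<open>\<lambda>\<^bsub>k - (i + 1) + 1\<^esub>\<close>. For a partition with
  \<open>lam 1 \<le> k\<close> none of the subtractions truncates.
\<close>

definition part_det :: "(nat \<Rightarrow> nat) \<Rightarrow> nat \<Rightarrow> int" where
  "part_det lam k =
     det (mat k k (\<lambda>(i, j). int ((2 * k - (i + 1) - lam (k - i)) choose (2 * k - 2 * (j + 1)))))"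

section \<open>Multivariate formal power series\<close>

text \<open>
  Formal power series in the variables \<open>X\<^sub>0, X\<^sub>1, \<dots>\<close>: a coefficient for every monomial, i.e. for
  every finitely supported exponent vector. Series in finitely many of the variables form a
  subring with the same coefficients.
\<close>

typedef 'a mfps = "UNIV :: ((nat \<Rightarrow>\<^sub>0 nat) \<Rightarrow> 'a) set"
  morphisms mcoeff Abs_mfps
  by simp

lemma mcoeff_Abs [simp]: "mcoeff (Abs_mfps f) = f"
  by (simp add: Abs_mfps_inverse)

lemma mfps_eqI: "(\<And>u. mcoeff f u = mcoeff g u) \<Longrightarrow> f = g"
  by (metis ext mcoeff_inject)

abbreviation msplits :: "(nat \<Rightarrow>\<^sub>0 nat) \<Rightarrow> ((nat \<Rightarrow>\<^sub>0 nat) \<times> (nat \<Rightarrow>\<^sub>0 nat)) set" where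
  "msplits u \<equiv> {(p, q). p + q = u}"

lemma finite_msplits: "finite (msplits u)"
proof -
  define B where "B = Max (insert 0 (Poly_Mapping.lookup u ` Poly_Mapping.keys u))"
  let ?F = "{f :: nat \<Rightarrow> nat. \<forall>x. (x \<in> Poly_Mapping.keys u \<longrightarrow> f x \<in> {..B}) \<and>
                                  (x \<notin> Poly_Mapping.keys u \<longrightarrow> f x = 0)}"
  have "finite ?F"
    by (rule finite_set_of_finite_funs) auto
  moreover have "Poly_Mapping.lookup p \<in> ?F \<and> Poly_Mapping.lookup q \<in> ?F" if "p + q = u" for p q
  proof -
    have *: "Poly_Mapping.lookup p x \<le> Poly_Mapping.lookup u x" "Poly_Mapping.lookup q x \<le> Poly_Mapping.lookup u x" for x
      unfolding that[symmetric] by (simp_all add: lookup_add)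
    have B: "Poly_Mapping.lookup u x \<le> B" if "x \<in> Poly_Mapping.keys u" for x
      using that by (auto simp: B_def intro!: Max_ge)
    have 0: "Poly_Mapping.lookup u x = 0" if "x \<notin> Poly_Mapping.keys u" for x
      using that by (simp add: in_keys_iff)
    have "Poly_Mapping.lookup p x \<in> {..B} \<and> Poly_Mapping.lookup q x \<in> {..B}" if "x \<in> Poly_Mapping.keys u" for x
      using *[of x] B[OF that] by simp
    moreover have "Poly_Mapping.lookup p x = 0 \<and> Poly_Mapping.lookup q x = 0" if "x \<notin> Poly_Mapping.keys u" for x
      using *[of x] 0[OF that] by simp
    ultimately show ?thesis
      by blast
  qed
  hence "(\<lambda>(p, q). (Poly_Mapping.lookup p, Poly_Mapping.lookup q)) ` msplits u \<subseteq> ?F \<times> ?F"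
    by auto
  ultimately have "finite ((\<lambda>(p, q). (Poly_Mapping.lookup p, Poly_Mapping.lookup q)) ` msplits u)"
    by (meson finite_SigmaI finite_subset)
  thus ?thesis
    by (rule finite_imageD) (auto simp: inj_on_def lookup_inject)
qed

instantiation mfps :: (comm_ring_1) comm_ring_1
begin

definition "0 = Abs_mfps (\<lambda>_. 0)"
definition "1 = Abs_mfps (\<lambda>u. if u = 0 then 1 else 0)"
definition "f + g = Abs_mfps (\<lambda>u. mcoeff f u + mcoeff g u)"
definition "f - g = Abs_mfps (\<lambda>u. mcoeff f u - mcoeff g u)"
definition "- f = Abs_mfps (\<lambda>u. - mcoeff f u)"
definition "f * g = Abs_mfps (\<lambda>u. \<Sum>(p, q)\<in>msplits u. mcoeff f p * mcoeff g q)"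

instance
proof
  fix f g h :: "'a mfps"
  show "f * g * h = f * (g * h)"
  proof (rule mfps_eqI)
    fix u
    have "mcoeff (f * g * h) u =
            (\<Sum>(r, c)\<in>msplits u. \<Sum>(a, b)\<in>msplits r. mcoeff f a * mcoeff g b * mcoeff h c)"
      by (simp add: times_mfps_def sum_distrib_right case_prod_unfold)
    also have "\<dots> = (\<Sum>(a, s)\<in>msplits u. \<Sum>(b, c)\<in>msplits s. mcoeff f a * mcoeff g b * mcoeff h c)"
      unfolding case_prod_unfold
      by (subst (1 2) sum.Sigma, simp_all add: finite_msplits[unfolded case_prod_unfold])
         (rule sum.reindex_bij_witness
            [of _ "\<lambda>((a, s), (b, c)). ((a + b, c), (a, b))" "\<lambda>((r, c), (a, b)). ((a, b + c), (b, c))"];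
          auto simp: add_ac)
    also have "\<dots> = mcoeff (f * (g * h)) u"
      by (simp add: times_mfps_def sum_distrib_left case_prod_unfold mult_ac)
    finally show "mcoeff (f * g * h) u = mcoeff (f * (g * h)) u" .
  qed
  show "f * g = g * f"
    unfolding times_mfps_def
    by (rule arg_cong[of _ _ Abs_mfps], rule ext,
        rule sum.reindex_bij_witness[of _ "\<lambda>(p, q). (q, p)" "\<lambda>(p, q). (q, p)"])
       (auto simp: add_ac mult_ac)
  show "1 * f = f"
  proof (rule mfps_eqI)
    fix u
    have "mcoeff (1 * f) u = (\<Sum>(p, q)\<in>msplits u. if p = 0 then mcoeff f q else 0)"
      by (auto simp: times_mfps_def one_mfps_def intro!: sum.cong)
    also have "\<dots> = (\<Sum>(p, q)\<in>{(0 :: nat \<Rightarrow>\<^sub>0 nat, u)}. if p = 0 then mcoeff f q else 0)"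
      by (rule sum.mono_neutral_right) (auto simp: finite_msplits split: if_splits)
    finally show "mcoeff (1 * f) u = mcoeff f u"
      by simp
  qed
  show "(f + g) * h = f * h + g * h"
    by (rule mfps_eqI)
       (simp add: times_mfps_def plus_mfps_def algebra_simps case_prod_unfold sum.distrib)
  show "(0 :: 'a mfps) \<noteq> 1"
  proof
    assume "(0 :: 'a mfps) = 1"
    hence "mcoeff (0 :: 'a mfps) 0 = mcoeff 1 0"
      by (rule arg_cong)
    thus False
      by (simp add: zero_mfps_def one_mfps_def)
  qed
qed (auto intro!: mfps_eqI simp: plus_mfps_def minus_mfps_def uminus_mfps_def zero_mfps_def)

end

definition mvar :: "nat \<Rightarrow> 'a::comm_ring_1 mfps" where
  "mvar i = Abs_mfps (\<lambda>u. if u = Poly_Mapping.single i 1 then 1 else 0)"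

text \<open>
  The inverse of a unit; non-units are sent to 0. With this instance the library's
  \<^const>\<open>power_int\<close> is available for negative exponents.
\<close>

instantiation mfps :: (comm_ring_1) inverse
begin

definition "inverse (f :: 'a mfps) = (if f dvd 1 then THE g. f * g = 1 else 0)"
definition "f div g = f * inverse (g :: 'a mfps)"

instance ..

end

lemma mfps_inverse_unique:
  fixes f g :: "'a::comm_ring_1 mfps"
  assumes "f * g = 1"
  shows "inverse f = g"
proof -
  have "f dvd 1"
    using assms by (metis dvd_triv_left)
  moreover have "(THE g. f * g = 1) = g"
  proof (rule the_equality)
    fix h assume "f * h = 1"
    thus "h = g"
      using assms by (metis mult.assoc mult.commute mult_1)
  qed (fact assms)
  ultimately show ?thesis
    by (simp add: inverse_mfps_def)
qed

lemma mfps_inverse_one_minus_mvar: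
  "(1 - mvar i :: 'a::comm_ring_1 mfps) * inverse (1 - mvar i) = 1"
proof -
  define G :: "'a mfps" where
    "G = Abs_mfps (\<lambda>u. if \<exists>n. u = Poly_Mapping.single i n then 1 else 0)"
  have single_Suc: "Poly_Mapping.single i (Suc n) =
      Poly_Mapping.single i 1 + Poly_Mapping.single i n" for n
    by (simp flip: single_add)
  have "mcoeff (mvar i * G) u = (if \<exists>n. u = Poly_Mapping.single i (Suc n) then 1 else 0)" for u
  proof -
    let ?S = "{(p, q). p + q = u \<and> p = Poly_Mapping.single i 1 \<and>
                       (\<exists>n. q = Poly_Mapping.single i n)}"
    have "mcoeff (mvar i * G) u = (\<Sum>(p, q)\<in>msplits u. if (p, q) \<in> ?S then 1 else 0)"
      by (auto simp: times_mfps_def mvar_def G_def intro!: sum.cong)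
    also have "\<dots> = (\<Sum>x\<in>?S. 1)"
      by (rule sum.mono_neutral_cong_right) (auto simp: finite_msplits split: if_splits)
    also have "?S = (if \<exists>n. u = Poly_Mapping.single i (Suc n)
                     then {(Poly_Mapping.single i 1, u - Poly_Mapping.single i 1)} else {})"
      by (auto simp: single_Suc simp del: One_nat_def)
    finally show ?thesis
      by simp
  qed
  moreover have "(\<exists>n. u = Poly_Mapping.single i n) \<longleftrightarrow>
      u = 0 \<or> (\<exists>n. u = Poly_Mapping.single i (Suc n))" for u :: "nat \<Rightarrow>\<^sub>0 nat"
    by (metis not0_implies_Suc single_zero)
  moreover have "Poly_Mapping.single i (Suc n) \<noteq> 0" for n
    by (simp flip: keys_eq_empty)
  ultimately have "mcoeff (G - mvar i * G) u = mcoeff 1 u" for u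
    by (auto simp: minus_mfps_def one_mfps_def G_def)
  hence "(1 - mvar i) * G = 1"
    by (intro mfps_eqI) (simp add: left_diff_distrib)
  thus ?thesis
    using mfps_inverse_unique by metis
qed

text \<open>The exponent vector of \<open>X\<^sub>1\<^bsup>u 1\<^esup> \<cdots> X\<^sub>m\<^bsup>u m\<^esup>\<close>.\<close>

definition mexpo :: "nat \<Rightarrow> (nat \<Rightarrow> nat) \<Rightarrow> (nat \<Rightarrow>\<^sub>0 nat)" where
  "mexpo m u = (\<Sum>i=1..m. Poly_Mapping.single i (u i))"

end

theory Submission
  imports Defs "HOL-Computational_Algebra.Formal_Power_Series"
begin

text \<open>
  Put \<open>y = (1 + t) / 2\<close> and \<open>q = y (1 - y) = (1 - t\<^sup>2) / 4\<close>. Up to powers of 2, the rows of the determinant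
  are the even parts in \<open>t\<close> of the powers \<open>y\<^sup>a\<close> with \<open>a = k + r - 1 - \<lambda>\<^sub>r\<close>, i.e. the classes of these
  powers modulo the polynomials of degree below \<open>2 k\<close> that are antisymmetric under \<open>y \<mapsto> 1 - y\<close>. The
  functionals \<open>f \<mapsto> Res f dy / q\<^bsup>b + 1\<^esup>\<close> with \<open>k \<le> b < 2 k\<close> are coordinates on the same \<open>k\<close>-dimensional
  quotient. So evaluating them on the powers \<open>y\<^sup>a\<close> gives the same determinant up to a constant, which
  the empty partition determines. The residues are the coefficients occurring in the first formula,
  because \<open>(y\<^sub>i - y\<^sub>j) (1 - y\<^sub>i - y\<^sub>j) = q\<^sub>i - q\<^sub>j\<close> turns the product over pairs into a Vandermonde
  determinant.

  The residues, taken for all exponents \<open>a, b\<close>, form a matrix whose inverse consists of the coefficients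
  of the antisymmetric polynomials \<open>(1 - 2 y) q\<^sup>c\<close>. The exponents below \<open>2 k\<close> that are missing among the
  \<open>k + r - 1 - \<lambda>\<^sub>r\<close> are the \<open>k - j + \<mu>\<^sub>j\<close>, so Jacobi's identity for complementary minors and
  \<open>z = - y\<close> give the second formula.
\<close>

section \<open>Determinants\<close>

lemma det_mat_mult:
  fixes f g :: "nat \<Rightarrow> nat \<Rightarrow> 'a::comm_ring_1"
  shows "det (mat n n (\<lambda>(i, j). \<Sum>l<n. f i l * g l j)) =
    det (mat n n (\<lambda>(i, j). f i j)) * det (mat n n (\<lambda>(i, j). g i j))"
proof -
  have "mat n n (\<lambda>(i, j). \<Sum>l<n. f i l * g l j) =
      mat n n (\<lambda>(i, j). f i j) * mat n n (\<lambda>(i, j). g i j)"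
    by (rule eq_matI) (auto simp: scalar_prod_def lessThan_atLeast0)
  thus ?thesis
    by (simp add: det_mult[of _ n])
qed

lemma det_mat_cong:
  "(\<And>i j. i < n \<Longrightarrow> j < n \<Longrightarrow> f i j = g i j) \<Longrightarrow>
    det (mat n n (\<lambda>(i, j). f i j)) = det (mat n n (\<lambda>(i, j). g i j))"
  by (rule arg_cong[of _ _ det]) (auto intro: eq_matI)

lemma det_mat_transpose:
  "det (mat n n (\<lambda>(i, j). f j i)) = det (mat n n (\<lambda>(i, j). f i j))"
proof -
  have "mat n n (\<lambda>(i, j). f j i) = transpose_mat (mat n n (\<lambda>(i, j). f i j))"
    by (rule eq_matI) auto
  thus ?thesis
    by (simp add: det_transpose[of _ n])
qed

lemma prod_list_diag_mat: "prod_list (diag_mat (mat n n (\<lambda>(i, j). f i j))) = (\<Prod>i<n. f i i)"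
  by (simp add: prod_list_diag_prod lessThan_atLeast0)

lemma det_mat_lower_triangular:
  assumes "\<And>i j. i < j \<Longrightarrow> j < n \<Longrightarrow> f i j = 0"
  shows "det (mat n n (\<lambda>(i, j). f i j)) = (\<Prod>i<n. f i i)"
  using assms by (subst det_lower_triangular[of n]) (auto simp: prod_list_diag_mat)

lemma det_mat_upper_triangular:
  assumes "\<And>i j. j < i \<Longrightarrow> i < n \<Longrightarrow> f i j = 0"
  shows "det (mat n n (\<lambda>(i, j). f i j)) = (\<Prod>i<n. f i i)"
  using assms by (subst det_upper_triangular[of _ n]) (auto simp: prod_list_diag_mat)

lemma det_mat_scale_rows:
  "det (mat n n (\<lambda>(i, j). c i * f i j)) = (\<Prod>i<n. c i) * det (mat n n (\<lambda>(i, j). f i j))"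
proof -
  have "det (mat n n (\<lambda>(i, j). c i * f i j)) =
      det (mat n n (\<lambda>(i, j). \<Sum>l<n. (if i = l then c i else 0) * f l j))"
    by (rule det_mat_cong) (simp add: if_distrib[of "\<lambda>x. x * _"] cong: if_cong)
  thus ?thesis
    by (simp add: det_mat_mult det_mat_lower_triangular)
qed

lemma det_mat_scale_columns:
  "det (mat n n (\<lambda>(i, j). f i j * c j)) = det (mat n n (\<lambda>(i, j). f i j)) * (\<Prod>j<n. c j)"
  using det_mat_scale_rows[of n c "\<lambda>i j. f j i"] det_mat_transpose[of n "\<lambda>i j. c i * f j i"]
    det_mat_transpose[of n f]
  by (simp add: mult.commute)

text \<open>Conjugation by the antidiagonal permutation matrix \<open>J\<close>. As \<open>J\<close>
  is an involution, only the square of its determinant enters and its sign drops out.\<close>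

lemma det_mat_reverse:
  fixes f :: "nat \<Rightarrow> nat \<Rightarrow> 'a::comm_ring_1"
  shows "det (mat n n (\<lambda>(i, j). f (n - 1 - i) (n - 1 - j))) = det (mat n n (\<lambda>(i, j). f i j))"
proof -
  define J :: "nat \<Rightarrow> nat \<Rightarrow> 'a" where "J i j = (if j = n - 1 - i then 1 else 0)" for i j
  have J': "J i j = (if i = n - 1 - j then 1 else 0)" if "i < n" "j < n" for i j
    using that by (auto simp: J_def)
  have "det (mat n n (\<lambda>(i, j). J i j)) * det (mat n n (\<lambda>(i, j). J i j)) =
      det (mat n n (\<lambda>(i, j). \<Sum>l<n. J i l * J l j))"
    by (rule det_mat_mult[symmetric])
  also have "\<dots> = det (mat n n (\<lambda>(i, j). if i = j then 1 else 0))"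
    by (rule det_mat_cong) (auto simp: J_def if_distrib[of "\<lambda>x. x * _"] cong: if_cong)
  also have "\<dots> = 1"
    by (subst det_mat_lower_triangular) auto
  finally have JJ: "det (mat n n (\<lambda>(i, j). J i j)) * det (mat n n (\<lambda>(i, j). J i j)) = 1" .
  have "det (mat n n (\<lambda>(i, j). f (n - 1 - i) (n - 1 - j))) =
      det (mat n n (\<lambda>(i, j). \<Sum>l<n. J i l * (\<Sum>p<n. f l p * J p j)))"
  proof (rule det_mat_cong)
    fix i j assume ij: "i < n" "j < n"
    have "(\<Sum>p<n. f l p * J p j) = f l (n - 1 - j)" for l
    proof -
      have "(\<Sum>p<n. f l p * J p j) = (\<Sum>p<n. if p = n - 1 - j then f l p else 0)"
        by (rule sum.cong) (use ij in \<open>auto simp: J'\<close>)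
      thus ?thesis
        using ij by simp
    qed
    thus "f (n - 1 - i) (n - 1 - j) = (\<Sum>l<n. J i l * (\<Sum>p<n. f l p * J p j))"
      using ij by (simp add: J_def if_distrib[of "\<lambda>x. x * _"] cong: if_cong)
  qed
  also have "\<dots> = det (mat n n (\<lambda>(i, j). f i j)) *
      (det (mat n n (\<lambda>(i, j). J i j)) * det (mat n n (\<lambda>(i, j). J i j)))"
    unfolding det_mat_mult by (simp only: mult_ac)
  finally show ?thesis
    by (simp only: JJ mult_1_right)
qed

section \<open>Block triangular determinants\<close>

lemma det_mat_lower_left_zero:
  fixes f :: "nat \<Rightarrow> nat \<Rightarrow> 'a::idom"
  assumes "\<And>i j. m \<le> i \<Longrightarrow> i < m + n \<Longrightarrow> j < m \<Longrightarrow> f i j = 0"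
  shows "det (mat (m + n) (m + n) (\<lambda>(i, j). f i j)) =
    det (mat m m (\<lambda>(i, j). f i j)) * det (mat n n (\<lambda>(i, j). f (m + i) (m + j)))"
proof -
  have "mat (m + n) (m + n) (\<lambda>(i, j). f i j) = four_block_mat
      (mat m m (\<lambda>(i, j). f i j)) (mat m n (\<lambda>(i, j). f i (m + j)))
      (0\<^sub>m n m) (mat n n (\<lambda>(i, j). f (m + i) (m + j)))"
    by (rule eq_matI) (auto simp: assms)
  thus ?thesis
    by (simp add: det_four_block_mat_lower_left_zero[of _ m _ n])
qed

lemma det_mat_upper_right_zero:
  fixes f :: "nat \<Rightarrow> nat \<Rightarrow> 'a::idom"
  assumes "\<And>i j. i < m \<Longrightarrow> m \<le> j \<Longrightarrow> j < m + n \<Longrightarrow> f i j = 0"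
  shows "det (mat (m + n) (m + n) (\<lambda>(i, j). f i j)) =
    det (mat m m (\<lambda>(i, j). f i j)) * det (mat n n (\<lambda>(i, j). f (m + i) (m + j)))"
  using det_mat_lower_left_zero[of m n "\<lambda>i j. f j i"] assms
  by (simp add: det_mat_transpose[of _ "\<lambda>i j. f i j"]
      det_mat_transpose[of _ "\<lambda>i j. f (m + i) (m + j)"])

text \<open>Used to shrink size \<open>k\<close> to the number of nonzero parts: the rows of the
  zero parts form a unitriangular tail.\<close>

lemma det_mat_leading_block:
  fixes f :: "nat \<Rightarrow> nat \<Rightarrow> 'a::idom"
  assumes "m \<le> k"
    and "\<And>i j. m \<le> i \<Longrightarrow> i < k \<Longrightarrow> j < i \<Longrightarrow> f i j = 0"
    and "\<And>i. m \<le> i \<Longrightarrow> i < k \<Longrightarrow> f i i = 1"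
  shows "det (mat k k (\<lambda>(i, j). f i j)) = det (mat m m (\<lambda>(i, j). f i j))"
proof -
  obtain n where k: "k = m + n"
    using assms(1) le_Suc_ex by blast
  have "det (mat n n (\<lambda>(i, j). f (m + i) (m + j))) = 1"
    using assms by (subst det_mat_upper_triangular) (auto simp: k)
  thus ?thesis
    unfolding k by (subst det_mat_lower_left_zero) (use assms in \<open>auto simp: k\<close>)
qed

text \<open>The Newton polynomials \<open>N j\<close> vanish at the nodes before \<open>x j\<close>,
  so evaluating them gives a triangular matrix; their expansion in monomials is
  unitriangular.\<close>

lemma det_vandermonde:
  fixes x :: "nat \<Rightarrow> 'a::comm_ring_1"
  shows "det (mat n n (\<lambda>(i, j). x i ^ j)) = (\<Prod>j<n. \<Prod>i<j. x j - x i)"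
proof -
  define N where "N j = (\<Prod>l<j. [:- x l, 1:])" for j
  have N_Suc: "N (Suc j) = pCons 0 (N j) - smult (x j) (N j)" for j
    by (simp add: N_def)
  have N_high: "coeff (N j) i = 0" if "j < i" for i j
    using that by (induction j arbitrary: i)
      (auto simp: N_def[of 0] N_Suc coeff_pCons split: nat.splits)
  have N_top: "coeff (N j) j = 1" for j
    by (induction j) (auto simp: N_def[of 0] N_Suc N_high)
  have eval: "poly (N j) y = (\<Sum>i<n. y ^ i * coeff (N j) i)" if "j < n" for j y
  proof -
    have "degree (N j) \<le> j"
      by (rule degree_le) (simp add: N_high)
    hence "(\<Sum>i\<le>degree (N j). coeff (N j) i * y ^ i) = (\<Sum>i<n. coeff (N j) i * y ^ i)"
      using that by (intro sum.mono_neutral_left) (auto simp: coeff_eq_0)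
    thus ?thesis
      by (simp add: poly_altdef mult.commute)
  qed
  have "(\<Prod>j<n. \<Prod>i<j. x j - x i) = (\<Prod>j<n. poly (N j) (x j))"
    by (simp add: N_def poly_prod)
  also have "\<dots> = det (mat n n (\<lambda>(i, j). poly (N j) (x i)))"
  proof (rule det_mat_lower_triangular[symmetric])
    fix i j :: nat assume "i < j"
    thus "poly (N j) (x i) = 0"
      by (auto simp: N_def poly_prod intro!: prod_zero)
  qed
  also have "\<dots> = det (mat n n (\<lambda>(i, j). \<Sum>l<n. x i ^ l * coeff (N j) l))"
    by (rule det_mat_cong) (simp add: eval)
  also have "\<dots> = det (mat n n (\<lambda>(i, j). x i ^ j))"
    by (subst det_mat_mult, subst det_mat_upper_triangular[of n "\<lambda>l j. coeff (N j) l"])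
      (auto simp: N_high N_top)
  finally show ?thesis ..
qed

section \<open>Symmetric and antisymmetric polynomials\<close>

text \<open>
  As a polynomial in \<open>q = y (1 - y)\<close>, \<open>sym_poly a\<close> is the symmetrisation \<open>(y\<^sup>a + (1 - y)\<^sup>a) / 2\<close>.
  With \<open>y = (1 + t) / 2\<close> it is \<open>2\<^sup>-\<^sup>a\<close> times the even part of \<open>(1 + t)\<^sup>a\<close>, and \<open>q = (1 - t\<^sup>2) / 4\<close>.
\<close>

fun sym_poly :: "nat \<Rightarrow> rat poly" where
  "sym_poly 0 = 1"
| "sym_poly (Suc 0) = [:1 / 2:]"
| "sym_poly (Suc (Suc a)) = sym_poly (Suc a) - pCons 0 (sym_poly a)"

lemma coeff_sym_poly_eq_0: "a < 2 * i \<Longrightarrow> coeff (sym_poly a) i = 0"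
  by (induction a arbitrary: i rule: sym_poly.induct) (auto simp: coeff_pCons split: nat.splits)

lemma coeff_sym_poly_0: "coeff (sym_poly (Suc a)) 0 = 1 / 2"
  by (induction a rule: sym_poly.induct) auto

text \<open>Here \<open>c i\<close> is the value of a linear functional at q^i, so multiplication by
  q shifts the index. The bound on \<open>N\<close> keeps the truncated sums complete.\<close>

lemma sum_sym_poly_Suc_Suc:
  assumes "Suc (Suc a) < 2 * N"
  shows "(\<Sum>i<N. coeff (sym_poly (Suc (Suc a))) i * c i) =
    (\<Sum>i<N. coeff (sym_poly (Suc a)) i * c i) - (\<Sum>i<N. coeff (sym_poly a) i * c (Suc i))"
proof -
  obtain M where N: "N = Suc M" and "a < 2 * M"
    using assms by (cases N) auto
  have "(\<Sum>i<N. coeff (pCons 0 (sym_poly a)) i * c i) = (\<Sum>i<M. coeff (sym_poly a) i * c (Suc i))"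
    unfolding N by (subst sum.lessThan_Suc_shift) simp
  also have "\<dots> = (\<Sum>i<N. coeff (sym_poly a) i * c (Suc i))"
    using \<open>a < 2 * M\<close> by (simp add: N coeff_sym_poly_eq_0)
  finally show ?thesis
    by (simp add: left_diff_distrib sum_subtractf)
qed

text \<open>Compare coefficients of T^(2s) in the even part of (1 + T)^a, with q = (1 - T^2) / 4.
  The induction rests on (1 + T)^2 = 2 (1 + T) - 4 q.\<close>

lemma choose_double_eq_sum_sym_poly:
  assumes "a < 2 * N"
  shows "of_nat (a choose (2 * s)) =
    2 ^ a * (\<Sum>i<N. coeff (sym_poly a) i * ((-1) ^ s * of_nat (i choose s) / 4 ^ i))"
  using assms
proof (induction a arbitrary: s rule: sym_poly.induct)
  case 1
  then obtain M where "N = Suc M"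
    by (cases N) auto
  thus ?case
    by (simp add: sum.lessThan_Suc_shift coeff_1 binomial_eq_0_iff del: sum.lessThan_Suc)
       (cases s; simp)
next
  case 2
  then obtain M where "N = Suc M"
    by (cases N) auto
  thus ?case
    by (simp add: sum.lessThan_Suc_shift del: sum.lessThan_Suc) (cases s; simp)
next
  case (3 a)
  define c :: "nat \<Rightarrow> nat \<Rightarrow> rat" where "c s i = (-1) ^ s * of_nat (i choose s) / 4 ^ i" for s i
  have IH1: "of_nat (Suc a choose (2 * s)) = 2 ^ Suc a * (\<Sum>i<N. coeff (sym_poly (Suc a)) i * c s i)" for s
    unfolding c_def by (rule 3) (use 3 in simp)
  have IH2: "of_nat (a choose (2 * s)) = 2 ^ a * (\<Sum>i<N. coeff (sym_poly a) i * c s i)" for s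
    unfolding c_def by (rule 3) (use 3 in simp)
  have step: "2 ^ Suc (Suc a) * (\<Sum>i<N. coeff (sym_poly (Suc (Suc a))) i * c s i) =
      2 * of_nat (Suc a choose (2 * s)) - 2 ^ a * (\<Sum>i<N. coeff (sym_poly a) i * (4 * c s (Suc i)))"
    unfolding sum_sym_poly_Suc_Suc[OF "3.prems"] IH1
    by (simp add: algebra_simps sum_distrib_left)
  show ?case
    unfolding c_def[symmetric] step
  proof (cases s)
    case 0
    hence "4 * c s (Suc i) = c s i" for i
      by (simp add: c_def)
    thus "of_nat (Suc (Suc a) choose (2 * s)) = 2 * of_nat (Suc a choose (2 * s)) -
        2 ^ a * (\<Sum>i<N. coeff (sym_poly a) i * (4 * c s (Suc i)))"
      by (simp add: IH2[symmetric] 0)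
  next
    case (Suc t)
    \<comment> \<open>The relation 4 q = 1 - T^2, read off at T^(2s).\<close>
    hence "4 * c s (Suc i) = c s i - c t i" for i
      by (simp add: c_def field_simps)
    hence "2 ^ a * (\<Sum>i<N. coeff (sym_poly a) i * (4 * c s (Suc i))) =
        (of_nat (a choose (2 * s)) - of_nat (a choose (2 * t)) :: rat)"
      by (simp only: IH2 right_diff_distrib sum_subtractf)
    thus "of_nat (Suc (Suc a) choose (2 * s)) = 2 * of_nat (Suc a choose (2 * s)) -
        2 ^ a * (\<Sum>i<N. coeff (sym_poly a) i * (4 * c s (Suc i)))"
      by (simp add: Suc)
  qed
qed

text \<open>
  \<open>ballot a b\<close> is the coefficient of \<open>y\<^sup>b\<close> in \<open>y\<^sup>a (1 - y)\<^bsup>- b - 1\<^esup>\<close>, that is, the residue of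
  \<open>y\<^sup>a dy / q\<^bsup>b + 1\<^esup>\<close>. On \<open>y\<^sup>a\<close> with \<open>a \<le> 2 b\<close> this functional depends only on the symmetrisation.
\<close>

definition ballot :: "nat \<Rightarrow> nat \<Rightarrow> rat" where
  "ballot a b = (if a \<le> b then of_nat ((2 * b - a) choose b) else 0)"

text \<open>The residue form of y^(a+2) = y^(a+1) - q y^a, where q cancels one factor of the
  denominator. For the binomials it is Pascal's rule.\<close>

lemma ballot_Suc_Suc: "ballot (Suc (Suc a)) (Suc b) = ballot (Suc a) (Suc b) - ballot a b"
proof (cases "Suc a \<le> b")
  case True
  hence "2 * Suc b - Suc a = Suc (2 * b - a)" "2 * Suc b - Suc (Suc a) = 2 * b - a"
    by auto
  thus ?thesis
    using True by (simp add: ballot_def del: diff_Suc_Suc)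
next
  case False
  thus ?thesis
    by (cases "a = b") (auto simp: ballot_def)
qed

lemma ballot_self [simp]: "ballot a a = 1"
  by (simp add: ballot_def)

lemma ballot_0_left: "ballot 0 b = of_nat ((2 * b) choose b)"
  by (simp add: ballot_def)

lemma ballot_1_left: "0 < b \<Longrightarrow> ballot (Suc 0) b = of_nat ((2 * b) choose b) / 2"
proof -
  assume "0 < b"
  then obtain c where b: "b = Suc c"
    using gr0_implies_Suc by blast
  have "(Suc (2 * c) choose c) = (Suc (2 * c) choose Suc c)"
    by (rule binomial_symmetric[THEN trans]) auto
  hence "(2 * b choose b) = 2 * (Suc (2 * c) choose Suc c)"
    by (simp add: b)
  thus ?thesis
    by (simp add: ballot_def b)
qed

text \<open>The functional takes q^i to the residue of dy / q^(b-i+1), a central binomial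
  coefficient. For \<open>a \<le> 2 * b\<close> there is no residue at infinity, so y^a and (1 -
  y)^a have the same value; at \<open>a = 1\<close>, \<open>b = 0\<close> they differ.\<close>

lemma ballot_eq_sum_sym_poly:
  assumes "a < 2 * N" "a \<le> 2 * b"
  shows "ballot a b =
    (\<Sum>i<N. coeff (sym_poly a) i * (if i \<le> b then of_nat ((2 * (b - i)) choose (b - i)) else 0))"
  using assms
proof (induction a arbitrary: b rule: sym_poly.induct)
  case 1
  then obtain M where "N = Suc M"
    by (cases N) auto
  thus ?case
    by (simp add: sum.lessThan_Suc_shift ballot_0_left del: sum.lessThan_Suc)
next
  case 2
  then obtain M where "N = Suc M"
    by (cases N) auto
  thus ?case
    using 2 by (simp add: sum.lessThan_Suc_shift ballot_1_left del: sum.lessThan_Suc)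
next
  case (3 a)
  obtain c where b: "b = Suc c"
    using 3 by (cases b) auto
  have "ballot (Suc (Suc a)) b = ballot (Suc a) b - ballot a c"
    by (simp add: b ballot_Suc_Suc)
  thus ?case
    using 3 unfolding b by (subst sum_sym_poly_Suc_Suc) (simp_all cong: if_cong)
qed

section \<open>The determinant of the symmetrised powers\<close>

lemma sum_choose_Suc:
  fixes F :: "nat \<Rightarrow> 'a::comm_ring_1"
  shows "(\<Sum>j\<le>Suc r. of_nat (Suc r choose j) * F j) =
    (\<Sum>j\<le>r. of_nat (r choose j) * (F j + F (Suc j)))"
proof -
  have "(\<Sum>j\<le>Suc r. of_nat (Suc r choose j) * F j) =
      F 0 + (\<Sum>j\<le>r. of_nat (r choose Suc j) * F (Suc j)) + (\<Sum>j\<le>r. of_nat (r choose j) * F (Suc j))"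
    by (subst sum.atMost_Suc_shift) (simp add: algebra_simps sum.distrib)
  also have "F 0 + (\<Sum>j\<le>r. of_nat (r choose Suc j) * F (Suc j)) =
      (\<Sum>j\<le>Suc r. of_nat (r choose j) * F j)"
    by (subst sum.atMost_Suc_shift) simp
  finally show ?thesis
    by (simp add: binomial_eq_0 distrib_left sum.distrib)
qed

text \<open>Substitute \<open>y = 1 - (1 - y)\<close> in the factor \<open>y\<^sup>r\<close> of \<open>y\<^bsup>k + r\<^esup>\<close> and use \<open>y\<^sup>k (1 - y)\<^sup>j = q\<^sup>j y\<^bsup>k - j\<^esup>\<close>.\<close>

lemma sym_poly_add:
  assumes "r \<le> k"
  shows "sym_poly (k + r) = (\<Sum>j\<le>r. of_nat (r choose j) * (monom ((-1) ^ j) j * sym_poly (k - j)))"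
  using assms
proof (induction r arbitrary: k)
  case (Suc r)
  have "sym_poly (k + Suc r) =
      (\<Sum>j\<le>r. of_nat (r choose j) * (monom ((-1) ^ j) j * sym_poly (Suc k - j)))"
    using Suc.IH[of "Suc k"] Suc.prems by simp
  also have "\<dots> = (\<Sum>j\<le>r. of_nat (r choose j) * (monom ((-1) ^ j) j * sym_poly (k - j) +
      monom ((-1) ^ Suc j) (Suc j) * sym_poly (k - Suc j)))"
  proof (rule sum.cong)
    fix j assume "j \<in> {..r}"
    \<comment> \<open>Since \<open>j \<le> r < k\<close>, the index \<open>Suc k - j\<close> is at
      least 2 and the recurrence applies.\<close>
    then obtain l where "Suc k - j = Suc (Suc l)" "k - j = Suc l" "k - Suc j = l"
      using Suc.prems by (metis (no_types, lifting) Suc_diff_Suc Suc_diff_le Suc_le_eq atMost_iff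
          le_trans less_le_not_le nat_le_linear)
    thus "of_nat (r choose j) * (monom ((-1) ^ j) j * sym_poly (Suc k - j)) =
        of_nat (r choose j) * (monom ((-1) ^ j) j * sym_poly (k - j) +
        monom ((-1) ^ Suc j) (Suc j) * sym_poly (k - Suc j))"
      by (simp add: algebra_simps monom_Suc flip: minus_monom)
  qed simp
  finally show ?case
    by (simp only: sum_choose_Suc)
qed (simp add: monom_0)

text \<open>\<open>sym_poly_add\<close> factors the matrix into the unitriangular Pascal matrix and
  a triangular one, whose diagonal is a sign times the constant coefficient 1/2 of
  \<open>sym_poly (k - j)\<close>.\<close>

lemma det_sym_poly:
  "det (mat k k (\<lambda>(r, i). coeff (sym_poly (k + r)) i)) = (\<Prod>j<k. (-1) ^ j / 2)"
proof -
  define U where "U j i = coeff (monom ((-1) ^ j) j * sym_poly (k - j)) i" for j i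
  have "det (mat k k (\<lambda>(r, i). coeff (sym_poly (k + r)) i)) =
      det (mat k k (\<lambda>(r, i). \<Sum>j<k. of_nat (r choose j) * U j i))"
  proof (rule det_mat_cong)
    fix r i assume "r < k"
    have "coeff (sym_poly (k + r)) i = (\<Sum>j\<le>r. of_nat (r choose j) * U j i)"
      using \<open>r < k\<close> by (simp add: sym_poly_add coeff_sum U_def of_nat_poly)
    also have "\<dots> = (\<Sum>j<k. of_nat (r choose j) * U j i)"
      by (rule sum.mono_neutral_left) (use \<open>r < k\<close> in \<open>auto simp: binomial_eq_0_iff\<close>)
    finally show "coeff (sym_poly (k + r)) i = (\<Sum>j<k. of_nat (r choose j) * U j i)" .
  qed
  also have "\<dots> = (\<Prod>j<k. of_nat (j choose j)) * (\<Prod>j<k. U j j)"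
    unfolding det_mat_mult
    by (subst det_mat_lower_triangular, simp add: binomial_eq_0_iff,
        subst det_mat_upper_triangular) (simp_all add: U_def coeff_monom_mult)
  also have "\<dots> = (\<Prod>j<k. (-1) ^ j / 2)"
  proof -
    have U: "U j j = (-1) ^ j / 2" if "j < k" for j
      using that coeff_sym_poly_0[of "k - Suc j"]
      by (simp add: U_def coeff_monom_mult Suc_diff_Suc)
    have "(\<Prod>j<k. U j j) = (\<Prod>j<k. (-1) ^ j / 2)"
      by (rule prod.cong) (auto simp: U)
    thus ?thesis
      by simp
  qed
  finally show ?thesis .
qed

text \<open>Up to row factors 2^(a r), both matrices are the coefficient matrix of the
  \<open>sym_poly (a r)\<close> times a matrix independent of \<open>a\<close>.\<close>

lemma det_choose_double_eq_det_ballot: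
  assumes "\<And>r. r < k \<Longrightarrow> a r < 2 * k"
  shows "2 ^ k * 4 ^ (k choose 2) * det (mat k k (\<lambda>(r, s). of_nat (a r choose (2 * s)) :: rat)) =
    2 ^ (\<Sum>r<k. a r) * det (mat k k (\<lambda>(r, j). ballot (a r) (k + j)))"
proof -
  define P where "P a = det (mat k k (\<lambda>(r, i). coeff (sym_poly (a r)) i))" for a :: "nat \<Rightarrow> nat"
  define G where "G = det (mat k k (\<lambda>(i, j). if i \<le> k + j
    then of_nat ((2 * (k + j - i)) choose (k + j - i)) else (0::rat)))"
  define S where "S = (\<Prod>j<k. (-1::rat) ^ j)"
  have SS: "S * S = 1"
    unfolding S_def by (subst prod.distrib[symmetric]) simp
  have four: "(\<Prod>s<k. 4 ^ s) = (4::rat) ^ (k choose 2)"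
    by (induction k) (simp_all add: power_add numeral_2_eq_2 mult.commute)
  have ballot_det: "det (mat k k (\<lambda>(r, j). ballot (a r) (k + j))) = P a * G"
    if "\<And>r. r < k \<Longrightarrow> a r < 2 * k" for a :: "nat \<Rightarrow> nat"
  proof -
    have "det (mat k k (\<lambda>(r, j). ballot (a r) (k + j))) =
        det (mat k k (\<lambda>(r, j). \<Sum>i<k. coeff (sym_poly (a r)) i * (if i \<le> k + j
          then of_nat ((2 * (k + j - i)) choose (k + j - i)) else 0)))"
    proof (rule det_mat_cong)
      fix r j assume "r < k"
      hence "a r < 2 * k"
        by (rule that)
      thus "ballot (a r) (k + j) = (\<Sum>i<k. coeff (sym_poly (a r)) i * (if i \<le> k + j
          then of_nat ((2 * (k + j - i)) choose (k + j - i)) else 0))"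
        by (intro ballot_eq_sum_sym_poly) auto
    qed
    thus ?thesis
      by (simp only: det_mat_mult P_def G_def)
  qed
  \<comment> \<open>These are the exponents of the empty partition. There the \<open>ballot\<close>
    matrix is unitriangular and \<open>P\<close> is known, which determines
    \<open>G\<close>.\<close>
  have "P (\<lambda>r. k + r) * G = det (mat k k (\<lambda>(r, j). ballot (k + r) (k + j)))"
    by (rule ballot_det[symmetric]) simp
  also have "\<dots> = 1"
    by (subst det_mat_upper_triangular) (auto simp: ballot_def)
  finally have PG: "P (\<lambda>r. k + r) * G = 1" .
  have PS: "P (\<lambda>r. k + r) = S / 2 ^ k"
    by (simp add: P_def S_def det_sym_poly prod_dividef)
  have "S / 2 ^ k * G = 1"
    using PG by (simp only: PS)
  hence G: "2 ^ k = S * G"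
    by (simp add: field_simps)
  have "det (mat k k (\<lambda>(r, s). of_nat (a r choose (2 * s)) :: rat)) =
      det (mat k k (\<lambda>(r, s). 2 ^ a r *
        (\<Sum>i<k. coeff (sym_poly (a r)) i * ((-1) ^ s * of_nat (i choose s) / 4 ^ i))))"
    by (rule det_mat_cong, rule choose_double_eq_sum_sym_poly, rule assms)
  also have "\<dots> = (\<Prod>r<k. 2 ^ a r) * (P a * (\<Prod>s<k. (-1) ^ s * of_nat (s choose s) / 4 ^ s))"
    unfolding det_mat_scale_rows det_mat_mult P_def
    by (subst det_mat_lower_triangular) (auto simp: binomial_eq_0)
  also have "(\<Prod>s<k. (-1) ^ s * of_nat (s choose s) / 4 ^ s) = S / 4 ^ (k choose 2)"
    by (simp add: S_def prod_dividef four)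
  also have "(\<Prod>r<k. 2 ^ a r) = (2::rat) ^ (\<Sum>r<k. a r)"
    by (simp add: power_sum)
  finally have "2 ^ k * 4 ^ (k choose 2) * det (mat k k (\<lambda>(r, s). of_nat (a r choose (2 * s)) :: rat)) =
      2 ^ k * S * 2 ^ (\<Sum>r<k. a r) * P a"
    by simp
  also have "\<dots> = S * S * (2 ^ (\<Sum>r<k. a r) * (P a * G))"
    by (simp only: G mult_ac)
  finally show ?thesis
    using ballot_det[OF assms] by (simp add: SS)
qed

text \<open>
  \<open>antisym_num c t\<close> is the coefficient of \<open>z\<^sup>t\<close> in \<open>(1 + 2 z) (1 + z)\<^sup>c\<close>, and \<open>antisym_coeff c a\<close> that of
  \<open>y\<^sup>a\<close> in \<open>(1 - 2 y) q\<^sup>c\<close>. Since \<open>(1 - 2 y) dy = dq\<close>, the functionals of \<^const>\<open>ballot\<close> are dual to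
  these antisymmetric polynomials.
\<close>

definition antisym_num :: "nat \<Rightarrow> nat \<Rightarrow> rat" where
  "antisym_num c t = of_nat (c choose t) + 2 * (case t of 0 \<Rightarrow> 0 | Suc s \<Rightarrow> of_nat (c choose s))"

definition antisym_coeff :: "nat \<Rightarrow> nat \<Rightarrow> rat" where
  "antisym_coeff c a = (if c \<le> a then (-1) ^ (a - c) * antisym_num c (a - c) else 0)"

lemma antisym_coeff_0: "antisym_coeff 0 a = (if a = 0 then 1 else if a = 1 then -2 else 0)"
  by (cases a) (auto simp: antisym_coeff_def antisym_num_def split: nat.splits)

lemma antisym_coeff_Suc_0 [simp]: "antisym_coeff (Suc c) 0 = 0"
  by (simp add: antisym_coeff_def)

text \<open>Multiplication by q = y - y^2, read off at y^(a+1).\<close>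

lemma antisym_coeff_Suc_Suc:
  "antisym_coeff (Suc c) (Suc a) =
    antisym_coeff c a - (case a of 0 \<Rightarrow> 0 | Suc b \<Rightarrow> antisym_coeff c b)"
proof -
  have num: "antisym_num (Suc c) t = antisym_num c t + (case t of 0 \<Rightarrow> 0 | Suc s \<Rightarrow> antisym_num c s)" for t
    by (auto simp: antisym_num_def split: nat.splits)
  show ?thesis
  proof (cases "Suc c \<le> a")
    case True
    then obtain t where "a = Suc c + t"
      using le_Suc_ex by blast
    thus ?thesis
      by (simp add: antisym_coeff_def num algebra_simps Suc_diff_le)
  next
    case False
    thus ?thesis
      by (cases "a = c") (auto simp: antisym_coeff_def num split: nat.splits)
  qed
qed

text \<open>The residue of q^(c-b-1) dq, which vanishes unless c = b. The induction cancels one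
  factor q and so lowers \<open>c\<close> and \<open>b\<close> together.\<close>

lemma sum_antisym_coeff_ballot:
  "(\<Sum>a\<le>b. antisym_coeff c a * ballot a b) = (if c = b then 1 else 0)"
proof (induction c arbitrary: b)
  case 0
  show ?case
  proof (cases b)
    case (Suc d)
    hence "(\<Sum>a\<le>b. antisym_coeff 0 a * ballot a b) = ballot 0 b - 2 * ballot 1 b"
      by (simp add: sum.atMost_Suc_shift antisym_coeff_0 del: sum.atMost_Suc)
        (cases d; simp add: sum.atMost_Suc_shift antisym_coeff_0 del: sum.atMost_Suc)
    thus ?thesis
      using Suc by (simp add: ballot_0_left ballot_1_left)
  qed (simp add: antisym_coeff_0)
next
  case (Suc c)
  show ?case
  proof (cases b)
    case (Suc d)
    have shift: "(\<Sum>a\<le>d. (case a of 0 \<Rightarrow> 0 | Suc e \<Rightarrow> antisym_coeff c e) * ballot (Suc a) (Suc d)) =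
        (\<Sum>a\<le>d. antisym_coeff c a * ballot (Suc (Suc a)) (Suc d))"
    proof (cases d)
      case (Suc e)
      \<comment> \<open>The top term of the right-hand sum; its vanishing makes up for the term lost
        in the index shift.\<close>
      have "ballot (Suc (Suc (Suc e))) (Suc (Suc e)) = 0"
        by (simp add: ballot_def)
      thus ?thesis
        unfolding Suc by (subst sum.atMost_Suc_shift) simp
    qed (simp add: ballot_def)
    have "(\<Sum>a\<le>b. antisym_coeff (Suc c) a * ballot a b) =
        (\<Sum>a\<le>d. antisym_coeff c a * (ballot (Suc a) (Suc d) - ballot (Suc (Suc a)) (Suc d)))"
      unfolding Suc by (subst sum.atMost_Suc_shift)
        (simp add: antisym_coeff_Suc_Suc left_diff_distrib right_diff_distrib sum_subtractf shift)
    also have "\<dots> = (\<Sum>a\<le>d. antisym_coeff c a * ballot a d)"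
      by (simp add: ballot_Suc_Suc)
    finally show ?thesis
      using Suc.IH Suc by simp
  qed simp
qed

section \<open>Complementary minors and conjugate partitions\<close>

lemma sgn_prod:
  fixes f :: "'b \<Rightarrow> 'a::linordered_idom"
  shows "sgn (prod f A) = (\<Prod>x\<in>A. sgn (f x))"
  by (induction A rule: infinite_finite_induct) (simp_all add: sgn_mult)

text \<open>Orthogonality leaves only the values 1 and -1. The matrix takes the Vandermonde matrix
  of 0, ..., n-1 to that of the values of \<sigma>, and comparing signs counts inversions.\<close>

lemma det_permutation_mat:
  assumes "inj_on \<sigma> {..<n}" "\<sigma> ` {..<n} \<subseteq> {..<n}"
  shows "det (mat n n (\<lambda>(i, a). if \<sigma> i = a then 1 else 0 :: rat)) =
    (\<Prod>j<n. \<Prod>i<j. if \<sigma> i < \<sigma> j then 1 else -1)"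
proof -
  define P :: "nat \<Rightarrow> nat \<Rightarrow> rat" where "P i a = (if \<sigma> i = a then 1 else 0)" for i a
  define D where "D = det (mat n n (\<lambda>(i, a). P i a))"
  have select: "(\<Sum>a<n. P i a * g a) = g (\<sigma> i)" if "i < n" for g i
    using assms(2) that by (auto simp: P_def if_distrib[of "\<lambda>x. x * _"] cong: if_cong)
  have "D * D = det (mat n n (\<lambda>(i, j). \<Sum>a<n. P i a * P j a))"
    by (simp only: det_mat_mult det_mat_transpose[of n P] D_def)
  also have "\<dots> = det (mat n n (\<lambda>(i, j). if i = j then 1 else 0))"
  proof (rule det_mat_cong)
    fix i j assume "i < n" "j < n"
    thus "(\<Sum>a<n. P i a * P j a) = (if i = j then 1 else 0)"
      using assms(1) by (subst select) (auto simp: P_def inj_on_def)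
  qed
  also have "\<dots> = 1"
    by (subst det_mat_lower_triangular) auto
  finally have "D = 1 \<or> D = -1"
    by (simp add: square_eq_1_iff)
  hence "D = sgn D"
    by auto
  have "D * (\<Prod>j<n. \<Prod>i<j. of_nat j - of_nat i) = (\<Prod>j<n. \<Prod>i<j. of_nat (\<sigma> j) - of_nat (\<sigma> i))"
  proof -
    have "D * det (mat n n (\<lambda>(a, j). of_nat a ^ j)) = det (mat n n (\<lambda>(i, j). of_nat (\<sigma> i) ^ j))"
      unfolding D_def det_mat_mult[symmetric] by (rule det_mat_cong) (simp add: select)
    thus ?thesis
      by (simp only: det_vandermonde)
  qed
  moreover have "(\<Prod>j<n. \<Prod>i<j. of_nat j - of_nat i :: rat) > 0"
    by (intro prod_pos) simp
  ultimately have "sgn D = sgn (\<Prod>j<n. \<Prod>i<j. of_nat (\<sigma> j) - of_nat (\<sigma> i) :: rat)"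
    by (metis mult.right_neutral sgn_mult sgn_pos)
  also have "\<dots> = (\<Prod>j<n. \<Prod>i<j. sgn (of_nat (\<sigma> j) - of_nat (\<sigma> i)))"
    by (simp add: sgn_prod)
  also have "\<dots> = (\<Prod>j<n. \<Prod>i<j. if \<sigma> i < \<sigma> j then 1 else -1)"
  proof (intro prod.cong refl)
    fix i j assume "j \<in> {..<n}" "i \<in> {..<j}"
    hence "\<sigma> i \<noteq> \<sigma> j"
      using assms(1) by (auto simp: inj_on_def)
    thus "sgn (of_nat (\<sigma> j) - of_nat (\<sigma> i)) = (if \<sigma> i < \<sigma> j then 1 else -1 :: rat)"
      by (auto simp: sgn_if)
  qed
  finally show ?thesis
    using \<open>D = sgn D\<close> by (simp add: D_def P_def)
qed

text \<open>
  Jacobi's identity for complementary minors of the mutually inverse matrices \<^const>\<open>ballot\<close> and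
  \<^const>\<open>antisym_coeff\<close>.
\<close>

lemma det_ballot_complementary:
  assumes inj: "inj_on \<sigma> {..<2 * k}" and range: "\<sigma> ` {..<2 * k} \<subseteq> {..<2 * k}"
  shows "det (mat k k (\<lambda>(i, j). ballot (\<sigma> (k + i)) (k + j))) =
    det (mat (2 * k) (2 * k) (\<lambda>(i, a). if \<sigma> i = a then 1 else 0)) *
    det (mat k k (\<lambda>(c, i). antisym_coeff c (\<sigma> i)))"
proof -
  \<comment> \<open>\<open>W\<close> stacks the first \<open>k\<close> rows of the inverse of
    \<open>X\<close> on unit vectors. So \<open>W\<close> times \<open>X\<close> has an identity
    block above the chosen rows of \<open>ballot\<close>, and it remains to multiply
    determinants.\<close>
  define W where "W c i = (if c < k then antisym_coeff c (\<sigma> i) else if i = c then 1 else 0)" for c i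
  define X where "X i b = (\<Sum>a<2 * k. (if \<sigma> i = a then 1 else 0) * ballot a b)" for i b
  have X: "X i b = ballot (\<sigma> i) b" if "i < 2 * k" for i b
    using range that by (auto simp: X_def if_distrib[of "\<lambda>x. x * _"] cong: if_cong)
  have bij: "bij_betw \<sigma> {..<2 * k} {..<2 * k}"
    using endo_inj_surj[OF _ range inj] inj by (simp add: bij_betw_def)
  have WX: "(\<Sum>i<2 * k. W c i * X i b) =
      (if c < k then if c = b then 1 else 0 else ballot (\<sigma> c) b)" if "c < 2 * k" "b < 2 * k" for c b
  proof (cases "c < k")
    case True
    have "(\<Sum>i<2 * k. W c i * X i b) = (\<Sum>i<2 * k. antisym_coeff c (\<sigma> i) * ballot (\<sigma> i) b)"
      using True by (simp add: W_def X)
    also have "\<dots> = (\<Sum>a<2 * k. antisym_coeff c a * ballot a b)"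
      by (rule sum.reindex_bij_betw[OF bij])
    also have "\<dots> = (\<Sum>a\<le>b. antisym_coeff c a * ballot a b)"
      by (rule sum.mono_neutral_right) (use that in \<open>auto simp: ballot_def\<close>)
    finally show ?thesis
      using True by (simp add: sum_antisym_coeff_ballot)
  next
    case False
    thus ?thesis
      using that X[of c b] by (simp add: W_def if_distrib[of "\<lambda>x. x * _"] cong: if_cong)
  qed
  have "det (mat (2 * k) (2 * k) (\<lambda>(c, i). W c i)) =
      det (mat k k (\<lambda>(c, i). antisym_coeff c (\<sigma> i)))"
  proof -
    have "det (mat k k (\<lambda>(c, i). W (k + c) (k + i))) = 1"
      by (subst det_mat_lower_triangular) (auto simp: W_def)
    moreover have "det (mat k k (\<lambda>(c, i). W c i)) = det (mat k k (\<lambda>(c, i). antisym_coeff c (\<sigma> i)))"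
      by (rule det_mat_cong) (simp add: W_def)
    moreover have "det (mat (k + k) (k + k) (\<lambda>(c, i). W c i)) =
        det (mat k k (\<lambda>(c, i). W c i)) * det (mat k k (\<lambda>(c, i). W (k + c) (k + i)))"
      by (rule det_mat_lower_left_zero) (simp add: W_def)
    ultimately show ?thesis
      by (simp only: mult_2 mult_1_right)
  qed
  moreover have "det (mat (2 * k) (2 * k) (\<lambda>(i, b). X i b)) =
      det (mat (2 * k) (2 * k) (\<lambda>(i, a). if \<sigma> i = a then 1 else 0))"
    unfolding X_def det_mat_mult
    by (subst det_mat_upper_triangular[of _ ballot]) (auto simp: ballot_def[of "Suc _"] ballot_def)
  moreover have "det (mat (2 * k) (2 * k) (\<lambda>(c, b). \<Sum>i<2 * k. W c i * X i b)) =
      det (mat k k (\<lambda>(i, j). ballot (\<sigma> (k + i)) (k + j)))"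
  proof -
    define Y where "Y c b = (if c < k then if c = b then 1 else 0 else ballot (\<sigma> c) b)" for c b
    have "det (mat (2 * k) (2 * k) (\<lambda>(c, b). \<Sum>i<2 * k. W c i * X i b)) =
        det (mat (k + k) (k + k) (\<lambda>(c, b). Y c b))"
      unfolding mult_2[symmetric] Y_def by (rule det_mat_cong) (rule WX)
    also have "\<dots> = det (mat k k (\<lambda>(c, b). Y c b)) * det (mat k k (\<lambda>(c, b). Y (k + c) (k + b)))"
      by (rule det_mat_upper_right_zero) (simp add: Y_def)
    also have "det (mat k k (\<lambda>(c, b). Y c b)) = 1"
      by (subst det_mat_lower_triangular) (auto simp: Y_def)
    finally show ?thesis
      by (simp add: Y_def)
  qed
  ultimately show ?thesis
    by (simp add: det_mat_mult mult.commute)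
qed

text \<open>Both sides say that the box (r, j) lies in the Young diagram, since the rows reaching
  column j form an initial segment.\<close>

lemma le_conj_part_iff:
  assumes "is_partition lam" "1 \<le> r" "1 \<le> j"
  shows "r \<le> conj_part lam j \<longleftrightarrow> j \<le> lam r"
proof -
  define S where "S = {r. 1 \<le> r \<and> j \<le> lam r}"
  have fin: "finite S"
    by (rule finite_subset[of _ "{i. 1 \<le> i \<and> lam i \<noteq> 0}"])
      (use assms in \<open>auto simp: S_def is_partition_def\<close>)
  have mono: "lam b \<le> lam a" if "1 \<le> a" "a \<le> b" for a b
    using assms(1) that by (simp add: is_partition_def)
  show ?thesis
  proof
    assume "j \<le> lam r"
    hence "{1..r} \<subseteq> S"
      using mono by (force simp: S_def)
    from card_mono[OF fin this] show "r \<le> conj_part lam j"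
      by (simp add: conj_part_def S_def)
  next
    assume "r \<le> conj_part lam j"
    show "j \<le> lam r"
    proof (rule ccontr)
      assume "\<not> j \<le> lam r"
      have "S \<subseteq> {1..<r}"
      proof
        fix x assume "x \<in> S"
        thus "x \<in> {1..<r}"
          using mono[OF assms(2), of x] \<open>\<not> j \<le> lam r\<close> by (cases "r \<le> x") (auto simp: S_def)
      qed
      from card_mono[OF _ this] have "card S < r"
        using assms(2) by simp
      thus False
        using \<open>r \<le> conj_part lam j\<close> by (simp add: conj_part_def S_def)
    qed
  qed
qed

lemma part_length_eq_conj_part: "part_length lam = conj_part lam 1"
  by (simp add: part_length_def conj_part_def Suc_le_eq)

lemma part_eq_0_iff:
  assumes "is_partition lam" "1 \<le> i"
  shows "lam i = 0 \<longleftrightarrow> part_length lam < i"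
  using le_conj_part_iff[OF assms, of 1] by (auto simp: part_length_eq_conj_part)

lemma part_size_eq_sum:
  assumes "is_partition lam" "part_length lam \<le> k"
  shows "part_size lam = (\<Sum>r<k. lam (Suc r))"
proof -
  have "lam i = 0" if "k < i" for i
    using part_eq_0_iff[OF assms(1), of i] assms(2) that by simp
  hence "part_size lam = (\<Sum>i\<in>{1..k}. lam i)"
    unfolding part_size_def by (intro sum.mono_neutral_left) (auto simp: not_less[symmetric])
  thus ?thesis
    by (simp add: sum.atLeast1_atMost_eq)
qed

text \<open>Complementary minors for a permutation of the exponents below \<open>2 * k\<close>,
  whose sign cancels against the alternating signs in \<open>antisym_coeff\<close>.\<close>

lemma det_ballot_eq_det_antisym_num:
  assumes "is_partition lam" "part_length lam \<le> k" "lam 1 \<le> k"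
  shows "det (mat k k (\<lambda>(r, j). ballot (k + r - lam (Suc r)) (k + j))) =
    det (mat k k (\<lambda>(i, j). if i \<le> conj_part lam (Suc i) + j
      then antisym_num (k - 1 - j) (conj_part lam (Suc i) + j - i) else 0))"
proof -
  define mu where "mu = conj_part lam"
  \<comment> \<open>The first half lists the exponents \<open>k - j + mu j\<close> with
    \<open>j = k - i\<close>, the second half \<open>k + r - lam (Suc r)\<close> with
    \<open>i = k + r\<close>.\<close>
  define \<sigma> where "\<sigma> i = (if i < k then i + mu (k - i) else i - lam (Suc i - k))" for i
  have mono: "lam b \<le> lam a" if "1 \<le> a" "a \<le> b" for a b
    using assms(1) that by (simp add: is_partition_def)
  have galois: "r \<le> mu j \<longleftrightarrow> j \<le> lam r" if "1 \<le> r" "1 \<le> j" for r j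
    unfolding mu_def by (rule le_conj_part_iff[OF assms(1) that])
  have lam_le: "lam r \<le> k" if "1 \<le> r" for r
    using mono[of 1 r] assms(3) that by simp
  have mu_le: "mu j \<le> k" if "1 \<le> j" for j
  proof (rule ccontr)
    assume "\<not> mu j \<le> k"
    hence "j \<le> lam (Suc k)"
      using galois[of "Suc k" j] that by simp
    thus False
      using part_eq_0_iff[OF assms(1), of "Suc k"] assms(2) that by simp
  qed
  have mu_mono: "mu b \<le> mu a" if "1 \<le> a" "a \<le> b" for a b
  proof (cases "mu b = 0")
    case False
    hence "b \<le> lam (mu b)"
      using galois[of "mu b" b] that by simp
    thus ?thesis
      using galois[of "mu b" a] that False by simp
  qed simp
  have inc: "\<sigma> i < \<sigma> j" if "i < j" "j < k \<or> k \<le> i" for i j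
  proof (cases "j < k")
    case True
    hence "mu (k - i) \<le> mu (k - j)"
      using that by (intro mu_mono) auto
    thus ?thesis
      using that True by (simp add: \<sigma>_def)
  next
    case False
    hence "k \<le> i"
      using that by simp
    hence "lam (Suc j - k) \<le> lam (Suc i - k)" "lam (Suc i - k) \<le> k"
      using that by (auto intro!: mono lam_le)
    thus ?thesis
      using that \<open>k \<le> i\<close> by (simp add: \<sigma>_def)
  qed
  \<comment> \<open>The comparison asks whether the box (r + 1, k - i) lies in the diagram. Thus the
    two halves are disjoint and inversions correspond to boxes.\<close>
  have mixed: "(\<sigma> (k + r) < \<sigma> i \<longleftrightarrow> r < mu (k - i)) \<and> \<sigma> (k + r) \<noteq> \<sigma> i" if "i < k" for i r
  proof -
    have "Suc r \<le> mu (k - i) \<longleftrightarrow> k - i \<le> lam (Suc r)"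
      using that by (intro galois) auto
    thus ?thesis
      using lam_le[of "Suc r"] that by (cases "r < mu (k - i)") (auto simp: \<sigma>_def)
  qed
  have inj: "inj_on \<sigma> {..<2 * k}"
  proof (rule linorder_inj_onI)
    fix i j :: nat assume "i < j"
    show "\<sigma> i \<noteq> \<sigma> j"
    proof (cases "j < k \<or> k \<le> i")
      case True
      thus ?thesis
        using inc[OF \<open>i < j\<close>] by simp
    next
      case False
      thus ?thesis
        using mixed[of i "j - k"] by auto
    qed
  qed auto
  have range: "\<sigma> ` {..<2 * k} \<subseteq> {..<2 * k}"
  proof safe
    fix i assume "i < 2 * k"
    moreover have "mu (k - i) \<le> k" if "i < k"
      using that by (intro mu_le) auto
    ultimately show "\<sigma> i < 2 * k"
      by (auto simp: \<sigma>_def)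
  qed
  \<comment> \<open>Each inversion pairs an index \<open>i\<close> of the first half with one of the
    second; column \<open>k - i\<close> of the diagram supplies \<open>mu (k - i)\<close> of
    them.\<close>
  have sign: "(\<Prod>j<2 * k. \<Prod>i<j. if \<sigma> i < \<sigma> j then 1 else -1) = (\<Prod>i<k. (-1::rat) ^ mu (k - i))"
  proof -
    define s :: "nat \<Rightarrow> nat \<Rightarrow> rat" where "s i j = (if \<sigma> i < \<sigma> j then 1 else -1)" for i j
    have s1: "s i j = 1" if "i < j" "j < k \<or> k \<le> i" for i j
      using inc[OF that] by (simp add: s_def)
    have split: "(\<Prod>j<k + n. g j) = (\<Prod>j<k. g j) * (\<Prod>r<n. g (k + r))" for g :: "nat \<Rightarrow> rat" and n
      by (induction n) (simp_all add: mult.assoc)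
    have "(\<Prod>j<2 * k. \<Prod>i<j. s i j) = (\<Prod>j<k. \<Prod>i<j. s i j) * (\<Prod>r<k. \<Prod>i<k + r. s i (k + r))"
      by (simp only: mult_2 split)
    also have "(\<Prod>j<k. \<Prod>i<j. s i j) = 1"
      by (intro prod.neutral ballI) (auto simp: s1)
    also have "(\<Prod>r<k. \<Prod>i<k + r. s i (k + r)) = (\<Prod>r<k. \<Prod>i<k. s i (k + r))"
      by (intro prod.cong refl prod.mono_neutral_right) (auto simp: s1)
    also have "\<dots> = (\<Prod>i<k. \<Prod>r<k. s i (k + r))"
      by (rule prod.swap)
    also have "\<dots> = (\<Prod>i<k. (-1) ^ mu (k - i))"
    proof (rule prod.cong)
      fix i assume "i \<in> {..<k}"
      hence i: "i < k" by simp
      have "s i (k + r) = (if r < mu (k - i) then -1 else 1)" for r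
        using mixed[OF i, of r] by (auto simp: s_def)
      hence "(\<Prod>r<k. s i (k + r)) = (\<Prod>r\<in>{..<mu (k - i)}. -1)"
        using mu_le[of "k - i"] i by (intro prod.mono_neutral_cong_right) auto
      thus "(\<Prod>r<k. s i (k + r)) = (-1) ^ mu (k - i)"
        by simp
    qed simp
    finally show ?thesis
      by (simp add: s_def)
  qed
  define B where "B i j = (if i \<le> mu (Suc i) + j
    then antisym_num (k - 1 - j) (mu (Suc i) + j - i) else 0)" for i j
  have "det (mat k k (\<lambda>(c, i). antisym_coeff c (\<sigma> i))) = det (mat k k (\<lambda>(i, c). antisym_coeff c (\<sigma> i)))"
    by (rule det_mat_transpose)
  also have "\<dots> = det (mat k k (\<lambda>(i, j). antisym_coeff (k - 1 - j) (\<sigma> (k - 1 - i))))"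
    by (rule det_mat_reverse[symmetric])
  \<comment> \<open>The sign in \<open>antisym_coeff\<close> splits into a row and a column factor.
    The parts (-1)^i and (-1)^j cancel in the determinant, leaving the sign of \<sigma>.\<close>
  also have "\<dots> = det (mat k k (\<lambda>(i, j). (-1) ^ (mu (Suc i) + i) * (B i j * (-1) ^ j)))"
  proof (rule det_mat_cong)
    fix i j assume ij: "i < k" "j < k"
    have "\<sigma> (k - 1 - i) = k - 1 - i + mu (Suc i)"
      using ij by (simp add: \<sigma>_def)
    moreover have "k - 1 - j \<le> k - 1 - i + mu (Suc i) \<longleftrightarrow> i \<le> mu (Suc i) + j"
      using ij by auto
    moreover have "k - 1 - i + mu (Suc i) - (k - 1 - j) = mu (Suc i) + j - i"
      using ij by auto
    moreover have "(-1::rat) ^ (mu (Suc i) + j - i) = (-1) ^ (mu (Suc i) + i) * (-1) ^ j"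
      if le: "i \<le> mu (Suc i) + j"
    proof -
      obtain t where "mu (Suc i) + j = i + t"
        using le_Suc_ex[OF le] by blast
      thus ?thesis
        by (simp add: power_add[symmetric] add_ac) (simp add: power_add)
    qed
    ultimately show "antisym_coeff (k - 1 - j) (\<sigma> (k - 1 - i)) =
        (-1) ^ (mu (Suc i) + i) * (B i j * (-1) ^ j)"
      by (simp add: antisym_coeff_def B_def)
  qed
  also have "\<dots> = (\<Prod>i<k. (-1) ^ mu (Suc i)) * (\<Prod>i<k. (-1) ^ i * (-1) ^ i) *
      det (mat k k (\<lambda>(i, j). B i j))"
    unfolding det_mat_scale_rows det_mat_scale_columns
    by (simp only: power_add prod.distrib mult_ac)
  also have "(\<Prod>i<k. (-1::rat) ^ mu (Suc i)) = (\<Prod>i<k. (-1) ^ mu (k - i))"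
    by (rule prod.reindex_bij_witness[of _ "\<lambda>i. k - 1 - i" "\<lambda>i. k - 1 - i"]) auto
  finally have antisym: "det (mat k k (\<lambda>(c, i). antisym_coeff c (\<sigma> i))) =
      (\<Prod>i<k. (-1) ^ mu (k - i)) * det (mat k k (\<lambda>(i, j). B i j))"
    by simp
  have "(\<Prod>i<k. (-1::rat) ^ mu (k - i)) * (\<Prod>i<k. (-1) ^ mu (k - i)) = 1"
    by (subst prod.distrib[symmetric]) simp
  hence "det (mat k k (\<lambda>(i, j). ballot (\<sigma> (k + i)) (k + j))) = det (mat k k (\<lambda>(i, j). B i j))"
    by (simp only: det_ballot_complementary[OF inj range] det_permutation_mat[OF inj range] sign
        antisym mult.assoc[symmetric] mult_1)
  moreover have "\<sigma> (k + r) = k + r - lam (Suc r)" for r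
    by (simp add: \<sigma>_def)
  ultimately show ?thesis
    by (simp only: B_def mu_def)
qed

section \<open>Coefficients of products of univariate series\<close>

lemma mcoeff_0 [simp]: "mcoeff 0 u = 0"
  by (simp add: zero_mfps_def)

lemma mcoeff_1: "mcoeff 1 u = (if u = 0 then 1 else 0)"
  by (simp add: one_mfps_def)

lemma mcoeff_add [simp]: "mcoeff (f + g) u = mcoeff f u + mcoeff g u"
  by (simp add: plus_mfps_def)

lemma mcoeff_diff [simp]: "mcoeff (f - g) u = mcoeff f u - mcoeff g u"
  by (simp add: minus_mfps_def)

lemma mcoeff_uminus [simp]: "mcoeff (- f) u = - mcoeff f u"
  by (simp add: uminus_mfps_def)

lemma mcoeff_mult: "mcoeff (f * g) u = (\<Sum>(p, q)\<in>msplits u. mcoeff f p * mcoeff g q)"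
  by (simp add: times_mfps_def)

lemma mcoeff_sum: "mcoeff (sum f A) u = (\<Sum>x\<in>A. mcoeff (f x) u)"
  by (induction A rule: infinite_finite_induct) auto

lemma mcoeff_sign_mult: "mcoeff (of_int (sign p) * f) u = of_int (sign p) * mcoeff f u"
  by (simp add: sign_def)

section \<open>Univariate series in one of the variables\<close>

definition mfps_of_fps :: "nat \<Rightarrow> 'a::comm_ring_1 fps \<Rightarrow> 'a mfps" where
  "mfps_of_fps i f = Abs_mfps (\<lambda>u. if \<forall>j. j \<noteq> i \<longrightarrow> Poly_Mapping.lookup u j = 0
    then fps_nth f (Poly_Mapping.lookup u i) else 0)"

lemma mcoeff_mfps_of_fps:
  "mcoeff (mfps_of_fps i f) u = (if \<forall>j. j \<noteq> i \<longrightarrow> Poly_Mapping.lookup u j = 0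
    then fps_nth f (Poly_Mapping.lookup u i) else 0)"
  by (simp add: mfps_of_fps_def)

text \<open>A power of one variable splits only into powers of it, which gives the Cauchy product.
  Any other variable in \<open>u\<close> occurs in a factor of each splitting and kills the
  summand.\<close>

lemma mfps_of_fps_mult:
  "mfps_of_fps i (f * g) = mfps_of_fps i f * mfps_of_fps i (g :: 'a::comm_ring_1 fps)"
proof (rule mfps_eqI)
  fix u
  show "mcoeff (mfps_of_fps i (f * g)) u = mcoeff (mfps_of_fps i f * mfps_of_fps i g) u"
  proof (cases "\<forall>j. j \<noteq> i \<longrightarrow> Poly_Mapping.lookup u j = 0")
    case True
    define n where "n = Poly_Mapping.lookup u i"
    have u: "u = Poly_Mapping.single i n"
      by (rule poly_mapping_eqI) (use True in \<open>auto simp: n_def lookup_single when_def\<close>)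
    have "mcoeff (mfps_of_fps i f * mfps_of_fps i g) u =
        (\<Sum>(p, q)\<in>msplits u. fps_nth f (Poly_Mapping.lookup p i) * fps_nth g (Poly_Mapping.lookup q i))"
      unfolding mcoeff_mult
    proof (intro sum.cong refl)
      fix x assume "x \<in> msplits u"
      then obtain p q where x: "x = (p, q)" and "p + q = u"
        by auto
      hence "Poly_Mapping.lookup p j = 0 \<and> Poly_Mapping.lookup q j = 0" if "j \<noteq> i" for j
        using True that by (auto simp: lookup_add)
      thus "(case x of (p, q) \<Rightarrow> mcoeff (mfps_of_fps i f) p * mcoeff (mfps_of_fps i g) q) =
          (case x of (p, q) \<Rightarrow>
            fps_nth f (Poly_Mapping.lookup p i) * fps_nth g (Poly_Mapping.lookup q i))"
        by (simp add: x mcoeff_mfps_of_fps)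
    qed
    also have "\<dots> = (\<Sum>a=0..n. fps_nth f a * fps_nth g (n - a))"
    proof (rule sum.reindex_bij_witness[of _
          "\<lambda>a. (Poly_Mapping.single i a, Poly_Mapping.single i (n - a))"
          "\<lambda>(p, q). Poly_Mapping.lookup p i"], goal_cases)
      case (1 x)
      then obtain p q where x: "x = (p, q)" and pq: "p + q = u"
        by auto
      have sum: "Poly_Mapping.lookup p j + Poly_Mapping.lookup q j = (if j = i then n else 0)" for j
        by (simp add: lookup_add[symmetric] pq u lookup_single when_def)
      have j: "Poly_Mapping.lookup p j = 0 \<and> Poly_Mapping.lookup q j = 0" if "j \<noteq> i" for j
        using that sum[of j] by simp
      have i: "Poly_Mapping.lookup p i + Poly_Mapping.lookup q i = n"
        using pq by (auto simp: n_def lookup_add)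
      show ?case
        using i j by (auto simp: x intro!: poly_mapping_eqI simp: lookup_single when_def)
    next
      case (2 x)
      have "Poly_Mapping.lookup (fst x) i + Poly_Mapping.lookup (snd x) i = n"
        using 2 by (auto simp: n_def lookup_add)
      thus ?case
        by (auto simp: case_prod_unfold)
    next
      case (4 a)
      thus ?case
        by (simp add: u flip: single_add)
    next
      case (5 x)
      have "Poly_Mapping.lookup (fst x) i + Poly_Mapping.lookup (snd x) i = n"
        using 5 by (auto simp: n_def lookup_add)
      thus ?case
        by (auto simp: case_prod_unfold)
    qed auto
    also have "\<dots> = mcoeff (mfps_of_fps i (f * g)) u"
      using True by (simp add: mcoeff_mfps_of_fps fps_mult_nth n_def)
    finally show ?thesis ..
  next
    case False
    then obtain j where j: "j \<noteq> i" "Poly_Mapping.lookup u j \<noteq> 0"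
      by blast
    have "mcoeff (mfps_of_fps i f) p * mcoeff (mfps_of_fps i g) q = 0" if "p + q = u" for p q
    proof -
      have "Poly_Mapping.lookup p j \<noteq> 0 \<or> Poly_Mapping.lookup q j \<noteq> 0"
        using j(2) by (auto simp: lookup_add simp flip: that)
      thus ?thesis
        using j(1) by (auto simp: mcoeff_mfps_of_fps)
    qed
    hence "mcoeff (mfps_of_fps i f * mfps_of_fps i g) u = 0"
      unfolding mcoeff_mult by (intro sum.neutral) auto
    thus ?thesis
      by (simp only: mcoeff_mfps_of_fps False if_False)
  qed
qed

interpretation mfps_of_fps: comm_ring_hom "mfps_of_fps i"
proof
  fix f g :: "'a fps"
  have 0: "u = 0 \<longleftrightarrow> (\<forall>j. j \<noteq> i \<longrightarrow> Poly_Mapping.lookup u j = 0) \<and> Poly_Mapping.lookup u i = 0"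
    for u :: "nat \<Rightarrow>\<^sub>0 nat"
    by (metis lookup_zero poly_mapping_eqI)
  show "mfps_of_fps i 1 = (1 :: 'a mfps)"
    by (rule mfps_eqI) (auto simp: mcoeff_mfps_of_fps mcoeff_1 0)
qed (auto intro!: mfps_eqI simp: mcoeff_mfps_of_fps mfps_of_fps_mult)

lemma mfps_of_fps_X: "mfps_of_fps i fps_X = mvar i"
proof (rule mfps_eqI)
  fix u :: "nat \<Rightarrow>\<^sub>0 nat"
  have "u = Poly_Mapping.single i 1 \<longleftrightarrow>
      (\<forall>j. j \<noteq> i \<longrightarrow> Poly_Mapping.lookup u j = 0) \<and> Poly_Mapping.lookup u i = 1"
    by (auto intro!: poly_mapping_eqI simp: lookup_single when_def)
  thus "mcoeff (mfps_of_fps i fps_X) u = mcoeff (mvar i :: 'a mfps) u"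
    by (auto simp: mcoeff_mfps_of_fps mvar_def)
qed

text \<open>Variables separate: the only splitting of \<open>u\<close> that can contribute puts the
  whole power of the new variable into its own factor.\<close>

lemma mcoeff_prod_mfps_of_fps:
  assumes "finite A"
  shows "mcoeff (\<Prod>i\<in>A. mfps_of_fps i (f i)) u =
    (if \<forall>j. j \<notin> A \<longrightarrow> Poly_Mapping.lookup u j = 0
     then \<Prod>i\<in>A. fps_nth (f i) (Poly_Mapping.lookup u i) else 0)"
  using assms
proof (induction A arbitrary: u)
  case empty
  have "u = 0 \<longleftrightarrow> (\<forall>j. Poly_Mapping.lookup u j = 0)"
    by (auto intro: poly_mapping_eqI)
  thus ?case
    by (simp add: mcoeff_1)
next
  case (insert x A)
  define G where "G = (\<Prod>i\<in>A. mfps_of_fps i (f i))"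
  define t where "t = Poly_Mapping.single x (Poly_Mapping.lookup u x)"
  have summand: "mcoeff (mfps_of_fps x (f x)) p * mcoeff G q = 0 \<or> (\<forall>j. j \<notin> insert x A \<longrightarrow> Poly_Mapping.lookup u j = 0) \<and>
      (p, q) = (t, u - t)" if "p + q = u" for p q
  proof (cases "mcoeff (mfps_of_fps x (f x)) p * mcoeff G q = 0")
    case False
    hence p: "Poly_Mapping.lookup p j = 0" if "j \<noteq> x" for j
      using that by (auto simp: mcoeff_mfps_of_fps split: if_splits)
    have q: "Poly_Mapping.lookup q j = 0" if "j \<notin> A" for j
      using that False by (auto simp: G_def insert.IH split: if_splits)
    have u: "Poly_Mapping.lookup u j = Poly_Mapping.lookup p j + Poly_Mapping.lookup q j" for j
      by (simp add: lookup_add flip: that)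
    have "p = t"
      using p q[OF insert.hyps(2)]
      by (intro poly_mapping_eqI) (auto simp: t_def lookup_single when_def u)
    moreover have "q = u - t"
      using that \<open>p = t\<close> by auto
    ultimately show ?thesis
      using p q by (auto simp: u)
  qed simp
  show ?case
  proof (cases "\<forall>j. j \<notin> insert x A \<longrightarrow> Poly_Mapping.lookup u j = 0")
    case True
    have tu: "t + (u - t) = u"
      by (rule poly_mapping_eqI) (auto simp: t_def lookup_add lookup_minus lookup_single when_def)
    have "mcoeff (mfps_of_fps x (f x) * G) u =
        (\<Sum>(p, q)\<in>{(t, u - t)}. mcoeff (mfps_of_fps x (f x)) p * mcoeff G q)"
      unfolding mcoeff_mult
    proof (rule sum.mono_neutral_right)
      show "\<forall>z\<in>msplits u - {(t, u - t)}. (case z of (p, q) \<Rightarrow> mcoeff (mfps_of_fps x (f x)) p * mcoeff G q) = 0"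
        using summand by auto
    qed (use tu in \<open>auto simp: finite_msplits\<close>)
    also have "\<dots> = fps_nth (f x) (Poly_Mapping.lookup u x) * mcoeff G (u - t)"
      by (simp add: mcoeff_mfps_of_fps t_def lookup_single when_def)
    also have "mcoeff G (u - t) = (\<Prod>i\<in>A. fps_nth (f i) (Poly_Mapping.lookup u i))"
    proof -
      have "Poly_Mapping.lookup (u - t) j = (if j = x then 0 else Poly_Mapping.lookup u j)" for j
        by (simp add: t_def lookup_minus lookup_single when_def)
      thus ?thesis
        using True insert.hyps by (auto simp: G_def insert.IH intro!: prod.cong)
    qed
    finally show ?thesis
      using True insert.hyps by (simp add: G_def)
  next
    case False
    have "mcoeff (mfps_of_fps x (f x) * G) u = 0"
      unfolding mcoeff_mult
    proof (intro sum.neutral ballI)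
      fix z assume "z \<in> msplits u"
      thus "(case z of (p, q) \<Rightarrow> mcoeff (mfps_of_fps x (f x)) p * mcoeff G q) = 0"
        using False summand[of "fst z" "snd z"] by (auto simp: case_prod_unfold)
    qed
    thus ?thesis
      using False insert.hyps by (simp only: G_def prod.insert if_False not_False_eq_True)
  qed
qed

lemma lookup_mexpo: "Poly_Mapping.lookup (mexpo m u) j = (if j \<in> {1..m} then u j else 0)"
proof -
  have "Poly_Mapping.lookup (mexpo m u) j = (\<Sum>i=1..m. if i = j then u i else 0)"
    by (simp add: mexpo_def lookup_sum lookup_single when_def)
  thus ?thesis
    by simp
qed

text \<open>Row \<open>i\<close> involves only the variable with index \<open>Suc i\<close>, so each
  Leibniz term is a product over distinct variables.\<close>

lemma mcoeff_det_mfps_of_fps: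
  fixes F :: "nat \<Rightarrow> nat \<Rightarrow> 'a::comm_ring_1 fps"
  shows "mcoeff (det (mat m m (\<lambda>(i, j). mfps_of_fps (Suc i) (F i j)))) (mexpo m u) =
    det (mat m m (\<lambda>(i, j). fps_nth (F i j) (u (Suc i))))"
proof -
  have "mcoeff (\<Prod>i<m. mfps_of_fps (Suc i) (F i (p i))) (mexpo m u) =
      (\<Prod>i<m. fps_nth (F i (p i)) (u (Suc i)))" for p
  proof -
    have "(\<Prod>i<m. mfps_of_fps (Suc i) (F i (p i))) =
        (\<Prod>i\<in>{1..m}. mfps_of_fps i (F (i - 1) (p (i - 1))))"
      by (simp add: prod.atLeast1_atMost_eq)
    also have "mcoeff \<dots> (mexpo m u) = (\<Prod>i\<in>{1..m}. fps_nth (F (i - 1) (p (i - 1))) (u i))"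
      by (subst mcoeff_prod_mfps_of_fps) (auto simp: lookup_mexpo intro!: prod.cong)
    also have "\<dots> = (\<Prod>i<m. fps_nth (F i (p i)) (u (Suc i)))"
      by (simp add: prod.atLeast1_atMost_eq)
    finally show ?thesis .
  qed
  moreover have "(\<Prod>i=0..<m. mat m m (\<lambda>(i, j). G i j) $$ (i, p i)) = (\<Prod>i<m. G i (p i))"
    if "p permutes {0..<m}" for p and G :: "nat \<Rightarrow> nat \<Rightarrow> 'b::comm_ring_1"
  proof -
    have "p i < m" if "i < m" for i
      using permutes_in_image[OF \<open>p permutes {0..<m}\<close>, of i] that by simp
    thus ?thesis
      by (simp add: lessThan_atLeast0)
  qed
  ultimately show ?thesis
    by (simp add: det_def mcoeff_sum mcoeff_sign_mult lessThan_atLeast0)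
qed

text \<open>\<open>det_vandermonde\<close> subtracts the earlier node from the later one; reversing
  rows and columns together turns this round without a sign.\<close>

lemma prod_diff_eq_det:
  fixes x :: "nat \<Rightarrow> 'a::comm_ring_1"
  shows "(\<Prod>(i, j)\<in>{(i, j). 1 \<le> i \<and> i < j \<and> j \<le> m}. x i - x j) =
    det (mat m m (\<lambda>(i, j). x (Suc i) ^ (m - 1 - j)))"
proof -
  have "det (mat m m (\<lambda>(i, j). x (Suc i) ^ (m - 1 - j))) =
      det (mat m m (\<lambda>(i, j). x (Suc (m - 1 - i)) ^ (m - 1 - (m - 1 - j))))"
    by (rule det_mat_reverse[symmetric])
  also have "\<dots> = det (mat m m (\<lambda>(i, j). x (m - i) ^ j))"
    by (rule det_mat_cong) (simp add: Suc_diff_Suc)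
  also have "\<dots> = (\<Prod>j<m. \<Prod>i<j. x (m - j) - x (m - i))"
    by (rule det_vandermonde)
  also have "\<dots> = (\<Prod>(j, i)\<in>Sigma {..<m} (\<lambda>j. {..<j}). x (m - j) - x (m - i))"
    by (rule prod.Sigma) auto
  also have "\<dots> = (\<Prod>(i, j)\<in>{(i, j). 1 \<le> i \<and> i < j \<and> j \<le> m}. x i - x j)"
    by (rule prod.reindex_bij_witness[of _ "\<lambda>(i, j). (m - i, m - j)" "\<lambda>(j, i). (m - j, m - i)"]) auto
  finally show ?thesis ..
qed

text \<open>The common shape of the two formulas: \<open>Q\<close> yields the pair factors and
  \<open>F\<close> the single-variable factors, which are absorbed into the rows.\<close>

lemma mcoeff_vandermonde:
  fixes F Q :: "'a::comm_ring_1 fps"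
  shows "mcoeff ((\<Prod>(i, j)\<in>{(i, j). 1 \<le> i \<and> i < j \<and> j \<le> m}. mfps_of_fps i Q - mfps_of_fps j Q) *
      (\<Prod>l=1..m. mfps_of_fps l F)) (mexpo m u) =
    det (mat m m (\<lambda>(i, j). fps_nth (F * Q ^ (m - 1 - j)) (u (Suc i))))"
proof -
  have "(\<Prod>(i, j)\<in>{(i, j). 1 \<le> i \<and> i < j \<and> j \<le> m}. mfps_of_fps i Q - mfps_of_fps j Q) *
      (\<Prod>l=1..m. mfps_of_fps l F) =
      det (mat m m (\<lambda>(i, j). mfps_of_fps (Suc i) F * mfps_of_fps (Suc i) Q ^ (m - 1 - j)))"
    unfolding prod_diff_eq_det det_mat_scale_rows
    by (simp add: prod.atLeast1_atMost_eq mult.commute)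
  also have "\<dots> = det (mat m m (\<lambda>(i, j). mfps_of_fps (Suc i) (F * Q ^ (m - 1 - j))))"
    by (simp add: mfps_of_fps.hom_mult mfps_of_fps.hom_power)
  finally show ?thesis
    by (simp only: mcoeff_det_mfps_of_fps)
qed

section \<open>Powers of the geometric series\<close>

definition fps_geometric :: "'a::comm_ring_1 fps" where
  "fps_geometric = Abs_fps (\<lambda>_. 1)"

lemma one_minus_fps_X_mult_geometric: "(1 - fps_X) * fps_geometric = 1"
  by (rule fps_ext) (auto simp: fps_geometric_def left_diff_distrib)

text \<open>Multiplication by the geometric series takes partial sums, so the induction is the
  hockey-stick identity.\<close>

lemma fps_geometric_power_nth:
  "fps_nth (fps_geometric ^ Suc n) t = (of_nat ((n + t) choose n) :: 'a::comm_ring_1)"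
proof (induction n arbitrary: t)
  case 0
  show ?case
    by (simp add: fps_geometric_def)
next
  case (Suc n)
  have "fps_nth (fps_geometric ^ Suc (Suc n)) t =
      fps_nth (fps_geometric ^ Suc n * fps_geometric :: 'a fps) t"
    by (simp only: power_Suc2)
  also have "\<dots> = (\<Sum>s=0..t. of_nat ((n + s) choose n))"
    by (simp only: fps_mult_nth Suc) (simp add: fps_geometric_def)
  also have "\<dots> = (of_nat (\<Sum>s\<le>t. (n + s) choose n) :: 'a)"
    by (simp add: atLeast0AtMost)
  also have "(\<Sum>s\<le>t. (n + s) choose n) = (Suc n + t) choose Suc n"
    by (induction t) auto
  finally show ?case .
qed

lemma one_minus_mvar_powi: 
  "(1 - mvar l :: 'a::comm_ring_1 mfps) powi (- int k) = mfps_of_fps l (fps_geometric ^ k)"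
proof -
  have "(1 - mvar l :: 'a mfps) * mfps_of_fps l fps_geometric = mfps_of_fps l ((1 - fps_X) * fps_geometric)"
    by (simp only: mfps_of_fps.hom_mult mfps_of_fps.hom_minus mfps_of_fps.hom_one mfps_of_fps_X)
  hence "inverse (1 - mvar l :: 'a mfps) = mfps_of_fps l fps_geometric"
    by (intro mfps_inverse_unique) (simp add: one_minus_fps_X_mult_geometric)
  thus ?thesis
    by (simp add: power_int_def mfps_of_fps.hom_power)
qed

section \<open>The coefficient formulas\<close>

lemma part_le:
  assumes "is_partition lam" "lam 1 \<le> k" "1 \<le> r"
  shows "lam r \<le> k"
  using assms by (metis is_partition_def le_refl le_trans)

text \<open>After reversing rows and columns, \<open>det_choose_double_eq_det_ballot\<close>
  applies; the rest counts powers of 2.\<close>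

lemma part_det_eq_det_ballot:
  assumes "is_partition lam" "part_length lam \<le> k" "lam 1 \<le> k"
  shows "of_int (part_det lam k) = 2 powi (int (k choose 2) - int (part_size lam)) *
    det (mat k k (\<lambda>(r, j). ballot (k + r - lam (Suc r)) (k + j)))"
proof -
  define a where "a r = k + r - lam (Suc r)" for r
  define B where "B = det (mat k k (\<lambda>(r, j). ballot (a r) (k + j)))"
  define C where "C = k choose 2"
  define L where "L = part_size lam"
  have a: "a r < 2 * k" if "r < k" for r
    using that by (simp add: a_def)
  have "of_int (part_det lam k) = det (map_mat of_int (mat k k (\<lambda>(i, j).
      int ((2 * k - (i + 1) - lam (k - i)) choose (2 * k - 2 * (j + 1))))) :: rat mat)"
    by (simp only: of_int_hom.hom_det part_det_def)
  also have "map_mat of_int (mat k k (\<lambda>(i, j).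
        int ((2 * k - (i + 1) - lam (k - i)) choose (2 * k - 2 * (j + 1))))) =
      mat k k (\<lambda>(i, j). of_nat (a (k - 1 - i) choose (2 * (k - 1 - j))) :: rat)"
  proof (rule eq_matI)
    fix i j assume "i < dim_row (mat k k (\<lambda>(i, j). of_nat (a (k - 1 - i) choose (2 * (k - 1 - j))) :: rat))"
      "j < dim_col (mat k k (\<lambda>(i, j). of_nat (a (k - 1 - i) choose (2 * (k - 1 - j))) :: rat))"
    hence "i < k" "j < k"
      by simp_all
    moreover from this have "a (k - 1 - i) = 2 * k - (i + 1) - lam (k - i)"
        "2 * (k - 1 - j) = 2 * k - 2 * (j + 1)"
      by (simp_all add: a_def Suc_diff_Suc)
    ultimately show "map_mat of_int (mat k k (\<lambda>(i, j).
        int ((2 * k - (i + 1) - lam (k - i)) choose (2 * k - 2 * (j + 1))))) $$ (i, j) =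
      mat k k (\<lambda>(i, j). of_nat (a (k - 1 - i) choose (2 * (k - 1 - j))) :: rat) $$ (i, j)"
      by simp
  qed simp_all
  also have "det \<dots> = det (mat k k (\<lambda>(r, s). of_nat (a r choose (2 * s))))"
    by (rule det_mat_reverse)
  finally have det: "2 ^ k * 4 ^ C * of_int (part_det lam k) = 2 ^ (\<Sum>r<k. a r) * B"
    using det_choose_double_eq_det_ballot[OF a] by (simp only: B_def C_def)
  have "(\<Sum>r<k. a r) + L = (\<Sum>r<k. a r + lam (Suc r))"
    by (simp only: L_def part_size_eq_sum[OF assms(1,2)] sum.distrib)
  also have "\<dots> = (\<Sum>r<k. k + r)"
    by (rule sum.cong) (use part_le[OF assms(1,3)] in \<open>auto simp: a_def trans_le_add1\<close>)
  also have "\<dots> = k * k + (\<Sum>r<k. r)"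
    by (simp add: sum.distrib)
  also have "(\<Sum>r<k. r) = C"
    unfolding C_def by (induction k) (simp_all add: numeral_2_eq_2)
  \<comment> \<open>This form lets the factor 2^k 4^C cancel and leaves 2^C.\<close>
  also have "k * k = k + 2 * C"
    unfolding C_def by (induction k) (simp_all add: numeral_2_eq_2)
  finally have sum: "(\<Sum>r<k. a r) + L = k + 2 * C + C" .
  have "2 ^ k * 4 ^ C * (of_int (part_det lam k) * 2 ^ L) = 2 ^ ((\<Sum>r<k. a r) + L) * B"
    by (simp add: power_add det[symmetric])
  also have "\<dots> = 2 ^ k * 4 ^ C * (2 ^ C * B)"
  proof -
    have "(2::rat) ^ (k + 2 * C + C) = 2 ^ k * 4 ^ C * 2 ^ C"
      by (simp only: power_add power_mult) simp
    thus ?thesis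
      by (simp only: sum mult.assoc)
  qed
  finally have "of_int (part_det lam k) * 2 ^ L = 2 ^ C * B"
    by simp
  thus ?thesis
    by (simp add: power_int_diff field_simps C_def L_def B_def a_def)
qed

text \<open>With Q = X (1 - X), each pair factor is Q(y_i) - Q(y_j), so the coefficient is a
  determinant of univariate coefficients, which are the residues \<open>ballot\<close>.\<close>

lemma det_ballot_eq_mcoeff:
  assumes "is_partition lam" "m = part_length lam" "part_length lam \<le> k" "lam 1 \<le> k"
  shows "det (mat k k (\<lambda>(r, j). ballot (k + r - lam (Suc r)) (k + j))) =
    mcoeff ((\<Prod>(i, j)\<in>{(i, j). 1 \<le> i \<and> i < j \<and> j \<le> m}.
        (mvar i - mvar j) * (1 - mvar i - mvar j)) *
      (\<Prod>l=1..m. (1 - mvar l) powi (- int k - int m))) (mexpo m (\<lambda>i. lam i + m - i))"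
proof -
  define Q :: "rat fps" where "Q = fps_X * (1 - fps_X)"
  define F :: "rat fps" where "F = fps_geometric ^ (k + m)"
  have "mfps_of_fps i Q = mvar i * (1 - mvar i)" for i
    by (simp only: Q_def mfps_of_fps.hom_mult mfps_of_fps.hom_minus mfps_of_fps.hom_one mfps_of_fps_X)
  hence Q: "(mvar i - mvar j) * (1 - mvar i - mvar j) = mfps_of_fps i Q - mfps_of_fps j Q" for i j
    by (simp add: algebra_simps)
  have F: "(1 - mvar l) powi (- int k - int m) = mfps_of_fps l F" for l
    using one_minus_mvar_powi[of l "k + m"] by (simp add: F_def)
  have entry: "fps_nth (F * Q ^ (m - 1 - j)) (lam (Suc i) + m - Suc i) =
      ballot (k + i - lam (Suc i)) (k + j)" if "i < m" "j < m" for i j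
  proof -
    define d where "d = m - 1 - j"
    \<comment> \<open>The \<open>d\<close> factors 1 - X in \<open>Q ^ d\<close> each cancel one
      geometric series, leaving \<open>k + j + 1\<close> of them.\<close>
    have "k + m = Suc (k + j) + d"
      using that by (simp add: d_def)
    hence "F * Q ^ d = fps_X ^ d * fps_geometric ^ Suc (k + j) * ((1 - fps_X) * fps_geometric) ^ d"
      unfolding F_def Q_def by (simp only: power_add power_mult_distrib mult_ac)
    hence FQ: "F * Q ^ d = fps_X ^ d * fps_geometric ^ Suc (k + j)"
      by (simp only: one_minus_fps_X_mult_geometric power_one mult_1_right)
    \<comment> \<open>The subtraction truncates only for \<open>i > lam (Suc i) + j\<close>; then
      the exponent lies below \<open>d\<close>, and both the coefficient and \<open>ballot\<close>
      are 0.\<close>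
    define t where "t = lam (Suc i) + j - i"
    have lam: "lam (Suc i) \<le> k"
      using part_le[OF assms(1,4)] by simp
    have "lam (Suc i) + m - Suc i < d \<longleftrightarrow> \<not> i \<le> lam (Suc i) + j"
        "lam (Suc i) + m - Suc i - d = t"
      using that by (auto simp: d_def t_def)
    hence "fps_nth (F * Q ^ d) (lam (Suc i) + m - Suc i) =
        (if i \<le> lam (Suc i) + j then of_nat ((k + j + t) choose (k + j)) else 0)"
      unfolding FQ fps_X_power_mult_nth by (simp only: fps_geometric_power_nth) simp
    moreover have "2 * (k + j) - (k + i - lam (Suc i)) = k + j + t" if "i \<le> lam (Suc i) + j"
      using that lam by (simp add: t_def)
    ultimately show ?thesis
      using lam by (auto simp: ballot_def d_def)
  qed
  have 0: "lam (Suc i) = 0" if "m \<le> i" for i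
    using part_eq_0_iff[OF assms(1), of "Suc i"] that assms(2) by simp
  have "det (mat k k (\<lambda>(r, j). ballot (k + r - lam (Suc r)) (k + j))) =
      det (mat m m (\<lambda>(r, j). ballot (k + r - lam (Suc r)) (k + j)))"
    by (rule det_mat_leading_block) (use assms in \<open>auto simp: 0 ballot_def\<close>)
  also have "\<dots> = det (mat m m (\<lambda>(i, j). fps_nth (F * Q ^ (m - 1 - j)) (lam (Suc i) + m - Suc i)))"
    by (rule det_mat_cong) (rule entry[symmetric])
  finally show ?thesis
    unfolding Q F mcoeff_vandermonde .
qed

text \<open>The same scheme with Q = X (1 + X). The rows past \<open>n\<close> are unitriangular
  because \<open>antisym_num c 0 = 1\<close>.\<close>

lemma det_antisym_num_eq_mcoeff:
  assumes "\<And>i. n \<le> i \<Longrightarrow> mu (Suc i) = 0" "n \<le> k"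
  shows "det (mat k k (\<lambda>(i, j). if i \<le> mu (Suc i) + j
      then antisym_num (k - 1 - j) (mu (Suc i) + j - i) else 0)) =
    mcoeff ((\<Prod>(i, j)\<in>{(i, j). 1 \<le> i \<and> i < j \<and> j \<le> n}.
        (mvar i - mvar j) * (1 + mvar i + mvar j)) *
      (\<Prod>l=1..n. (1 + 2 * mvar l) * (1 + mvar l) powi (int k - int n)))
      (mexpo n (\<lambda>i. mu i + n - i))"
proof -
  define Q :: "rat fps" where "Q = fps_X * (1 + fps_X)"
  define F :: "rat fps" where "F = (1 + 2 * fps_X) * (1 + fps_X) ^ (k - n)"
  have "mfps_of_fps i Q = mvar i * (1 + mvar i)" for i
    by (simp only: Q_def mfps_of_fps.hom_mult mfps_of_fps.hom_add mfps_of_fps.hom_one mfps_of_fps_X)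
  hence Q: "(mvar i - mvar j) * (1 + mvar i + mvar j) = mfps_of_fps i Q - mfps_of_fps j Q" for i j
    by (simp add: algebra_simps)
  have powi: "x powi (int k - int n) = x ^ (k - n)" for x :: "rat mfps"
    using assms(2) by (simp add: power_int_def flip: of_nat_diff)
  have F: "(1 + 2 * mvar l) * (1 + mvar l) powi (int k - int n) = mfps_of_fps l F" for l
    by (simp only: F_def powi mfps_of_fps.hom_mult mfps_of_fps.hom_add mfps_of_fps.hom_one
        mfps_of_fps_X mfps_of_fps.hom_power mult_2)
  have num: "fps_nth ((1 + 2 * fps_X) * (1 + fps_X) ^ c) t = antisym_num c t" for c t
  proof -
    have "(1 + fps_X :: rat fps) ^ c = Abs_fps (\<lambda>t. of_nat (c choose t))"
      by (rule fps_ext) (simp add: fps_binomial_of_nat[symmetric] binomial_gbinomial)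
    thus ?thesis
      by (cases t) (simp_all add: antisym_num_def distrib_right mult.assoc numeral_fps_const)
  qed
  have entry: "fps_nth (F * Q ^ (n - 1 - j)) (mu (Suc i) + n - Suc i) =
      (if i \<le> mu (Suc i) + j then antisym_num (k - 1 - j) (mu (Suc i) + j - i) else 0)"
    if "i < n" "j < n" for i j
  proof -
    define d where "d = n - 1 - j"
    have "k - 1 - j = k - n + d"
      using that assms(2) by (simp add: d_def)
    hence FQ: "F * Q ^ d = fps_X ^ d * ((1 + 2 * fps_X) * (1 + fps_X) ^ (k - 1 - j))"
      unfolding F_def Q_def by (simp only: power_add power_mult_distrib mult_ac)
    have "mu (Suc i) + n - Suc i < d \<longleftrightarrow> \<not> i \<le> mu (Suc i) + j"
        "mu (Suc i) + n - Suc i - d = mu (Suc i) + j - i"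
      using that by (auto simp: d_def)
    thus ?thesis
      unfolding d_def[symmetric] FQ fps_X_power_mult_nth num by simp
  qed
  have "det (mat k k (\<lambda>(i, j). if i \<le> mu (Suc i) + j
        then antisym_num (k - 1 - j) (mu (Suc i) + j - i) else 0)) =
      det (mat n n (\<lambda>(i, j). if i \<le> mu (Suc i) + j
        then antisym_num (k - 1 - j) (mu (Suc i) + j - i) else 0))"
    by (rule det_mat_leading_block) (use assms in \<open>auto simp: antisym_num_def\<close>)
  also have "\<dots> = det (mat n n (\<lambda>(i, j). fps_nth (F * Q ^ (n - 1 - j)) (mu (Suc i) + n - Suc i)))"
    by (rule det_mat_cong) (rule entry[symmetric])
  finally show ?thesis
    unfolding Q F mcoeff_vandermonde .
qed

theorem theorem1p2:
  fixes lam mu :: "nat \<Rightarrow> nat" and m n k :: nat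
  assumes "is_partition lam"
    and "m = part_length lam"
    and "mu = conj_part lam"
    and "n = part_length mu"
    and "k \<ge> max (part_length lam) (lam 1)"
  shows "(of_int (part_det lam k) :: rat) =
           2 powi (int (k choose 2) - int (part_size lam)) *
           mcoeff
             ((\<Prod>(i, j)\<in>{(i, j). 1 \<le> i \<and> i < j \<and> j \<le> m}.
                 (mvar i - mvar j) * (1 - mvar i - mvar j)) *
              (\<Prod>l=1..m. (1 - mvar l) powi (- int k - int m)))
             (mexpo m (\<lambda>i. lam i + m - i))
       \<and> (of_int (part_det lam k) :: rat) =
           2 powi (int (k choose 2) - int (part_size lam)) *
           mcoeff
             ((\<Prod>(i, j)\<in>{(i, j). 1 \<le> i \<and> i < j \<and> j \<le> n}.
                 (mvar i - mvar j) * (1 + mvar i + mvar j)) *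
              (\<Prod>l=1..n. (1 + 2 * mvar l) * (1 + mvar l) powi (int k - int n)))
             (mexpo n (\<lambda>i. mu i + n - i))"
proof -
  have k: "part_length lam \<le> k" "lam 1 \<le> k"
    using assms(5) by simp_all
  have n: "n = lam 1"
    using part_length_conj_part[OF assms(1)] assms(3,4) by simp
  have mu0: "mu (Suc i) = 0" if "n \<le> i" for i
    using le_conj_part_iff[OF assms(1), of 1 "Suc i"] that by (auto simp: n assms(3))
  \<comment> \<open>Both formulas evaluate this one determinant of residues, directly and through
    the complementary minor.\<close>
  have conj: "det (mat k k (\<lambda>(r, j). ballot (k + r - lam (Suc r)) (k + j))) =
      det (mat k k (\<lambda>(i, j). if i \<le> mu (Suc i) + j
        then antisym_num (k - 1 - j) (mu (Suc i) + j - i) else 0))"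
    unfolding assms(3) by (rule det_ballot_eq_det_antisym_num[OF assms(1) k])
  show ?thesis
    unfolding part_det_eq_det_ballot[OF assms(1) k]
    using det_ballot_eq_mcoeff[OF assms(1,2) k] det_antisym_num_eq_mcoeff[of n mu k, OF mu0 k(2)[folded n]]
    by (simp only: conj)
qed

end
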